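(* Let $c\in\mathbb R$, $s,L>0$, and let the error density $g$ satisfy $\mathbb E_g(U^{2(c-1)})<\infty$. Assume there exist $c_g,C_g,\gamma>0$ such that $c_g(1+t^2)^{-\gamma/2}\le |\mathcal M_c[g](t)|\le C_g(1+t^2)^{-\gamma/2}$ for all $t\in\mathbb R$, and let $r>\max(0,\gamma^{-1}-1)$. Then there is a constant $C_{g,L,r}>0$ (for the fixed $c$ and $s$ depending on $g$, $L$, $r$, but not on $n$ or $f$) such that for all $n\in\mathbb N$, with $k_o:=n^{\gamma/(2s+2\gamma+1)}$, $$\sup_{f\in\mathbb D_c^s(L)}\mathbb E_{f_Y}^n\big(\|f-\widehat f_{k_o}\|_{x^{2c-1}}^2\big)\le C_{g,L,r}\,n^{-2s/(2s+2\gamma+1)}.$$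
   Context: Model: $X$ and $U$ are independent positive random variables with Lebesgue densities $f$ (unknown) and $g$ (known) on $\mathbb R_+=(0,\infty)$; $Y=XU$ has density $f_Y(y)=\int_0^\infty f(x)g(y/x)x^{-1}dx$. $Y_1,\dots,Y_n$ are i.i.d. copies of $Y$; $\mathbb E_{f_Y}^n$ is expectation under their joint law, and $\mathbb E_f,\mathbb E_g$ denote expectation when $X\sim f$, $U\sim g$. Norms: $\|h\|_{x^{2c-1}}^2=\int_0^\infty|h(x)|^2x^{2c-1}dx$, $\mathbb L^2(\mathbb R_+,x^{2c-1})$ is the space of measurable complex-valued functions on $\mathbb R_+$ for which this is finite, and $\|H\|_{\mathbb R}^2=\int_{\mathbb R}|H(t)|^2dt$. Mellin transform: $\mathcal M_c[h](t)=\int_0^\infty x^{c-1+it}h(x)dx$ for $t\in\mathbb R$, whenever $\int_0^\infty x^{c-1}|h(x)|dx<\infty$. Ridge estimator (with $\xi=0$): for $k>0$ set $$\mathrm R_k(t)=\frac{\mathcal M_c[g](-t)\,|\mathcal M_c[g](t)|^r}{\max(|\mathcal M_c[g](t)|,k^{-1})^{r+2}},\qquad \widehat{\mathcal M}_c(t)=\frac1n\sum_{j=1}^nY_j^{c-1+it},\qquad \widehat f_k(x)=\frac1{2\pi}\int_{-\infty}^\infty x^{-c-it}\,\widehat{\mathcal M}_c(t)\,\mathrm R_k(t)\,dt,\quad x>0.$$ Mellin-Sobolev classes: $\mathbb D_c^s(L)$ is the set of probability densities $f$ on $\mathbb R_+$ with $f\in\mathbb L^2(\mathbb R_+,x^{2c-1})$,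 $\mathbb E_f(X^{2(c-1)})\le L$ and $|f|_{s,c}^2:=\int_{\mathbb R}(1+t^2)^s|\mathcal M_c[f](t)|^2dt\le L$. *)

theory Defs
  imports "HOL-Analysis.Analysis"
begin

(* Functions on the half-line (0,oo) are HOL functions on all of real. Every notion below only
   looks at their values on {0<..}; the values elsewhere are irrelevant. *)

definition pos_density :: "(real \<Rightarrow> real) \<Rightarrow> bool" where
  "pos_density f \<longleftrightarrow>
     set_borel_measurable borel {0<..} f \<and> (\<forall>x>0. 0 \<le> f x) \<and>
     (\<integral>\<^sup>+x\<in>{0<..}. ennreal (f x) \<partial>lborel) = 1"

definition pos_law :: "(real \<Rightarrow> ennreal) \<Rightarrow> real measure" where
  "pos_law p = density lborel (\<lambda>x. p x * indicator {0<..} x)"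

(* E(X^a) in [0,oo], where X has density f. *)
definition pos_moment :: "(real \<Rightarrow> real) \<Rightarrow> real \<Rightarrow> ennreal" where
  "pos_moment f a = (\<integral>\<^sup>+x. ennreal (x powr a) \<partial>pos_law (\<lambda>x. ennreal (f x)))"

(* Density of the product of independent variables with densities f and g; [0,oo]-valued because
   the integral may diverge for y in a null set. *)
definition mult_conv :: "(real \<Rightarrow> real) \<Rightarrow> (real \<Rightarrow> real) \<Rightarrow> real \<Rightarrow> ennreal" where
  "mult_conv f g y = (\<integral>\<^sup>+x\<in>{0<..}. ennreal (f x * g (y / x) / x) \<partial>lborel)"

definition sample_law :: "nat \<Rightarrow> (real \<Rightarrow> real) \<Rightarrow> (real \<Rightarrow> real) \<Rightarrow> (nat \<Rightarrow> real) measure" where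
  "sample_law n f g = PiM {1..n} (\<lambda>_. pos_law (mult_conv f g))"

(* The squared norm of L^2((0,oo), x^(2c-1)), as a value in [0,oo]. *)
definition weighted_norm_sq :: "real \<Rightarrow> (real \<Rightarrow> complex) \<Rightarrow> ennreal" where
  "weighted_norm_sq c h =
     (\<integral>\<^sup>+x\<in>{0<..}. ennreal ((cmod (h x))\<^sup>2 * x powr (2 * c - 1)) \<partial>lborel)"

definition weighted_L2 :: "real \<Rightarrow> (real \<Rightarrow> complex) set" where
  "weighted_L2 c = {h. set_borel_measurable borel {0<..} h \<and> weighted_norm_sq c h < \<infinity>}"

(* To be used only for h such that x^(c-1) h(x) is absolutely integrable on (0,oo). *)
definition mellin :: "real \<Rightarrow> (real \<Rightarrow> complex) \<Rightarrow> real \<Rightarrow> complex" where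
  "mellin c h t =
     (LINT x:{0<..}|lborel. complex_of_real x powr Complex (c - 1) t * h x)"

abbreviation mellin_real :: "real \<Rightarrow> (real \<Rightarrow> real) \<Rightarrow> real \<Rightarrow> complex" where
  "mellin_real c f \<equiv> mellin c (\<lambda>x. complex_of_real (f x))"

definition ridge :: "real \<Rightarrow> (real \<Rightarrow> real) \<Rightarrow> real \<Rightarrow> real \<Rightarrow> real \<Rightarrow> complex" where
  "ridge c g r k t =
     mellin_real c g (- t) * complex_of_real (cmod (mellin_real c g t) powr r)
     / complex_of_real (max (cmod (mellin_real c g t)) (1 / k) powr (r + 2))"

definition empirical_mellin :: "real \<Rightarrow> nat \<Rightarrow> (nat \<Rightarrow> real) \<Rightarrow> real \<Rightarrow> complex" where
  "empirical_mellin c n Y t =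
     (\<Sum>j = 1..n. complex_of_real (Y j) powr Complex (c - 1) t) / of_nat n"

definition ridge_estimator ::
    "real \<Rightarrow> (real \<Rightarrow> real) \<Rightarrow> real \<Rightarrow> real \<Rightarrow> nat \<Rightarrow> (nat \<Rightarrow> real) \<Rightarrow> real \<Rightarrow> complex" where
  "ridge_estimator c g r k n Y x =
     1 / complex_of_real (2 * pi) *
     (LINT t|lborel. complex_of_real x powr Complex (- c) (- t)
        * empirical_mellin c n Y t * ridge c g r k t)"

definition ridge_risk ::
    "real \<Rightarrow> (real \<Rightarrow> real) \<Rightarrow> real \<Rightarrow> real \<Rightarrow> nat \<Rightarrow> (real \<Rightarrow> real) \<Rightarrow> ennreal" where
  "ridge_risk c g r k n f =
     (\<integral>\<^sup>+Y. weighted_norm_sq c (\<lambda>x. complex_of_real (f x) - ridge_estimator c g r k n Y x)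
        \<partial>sample_law n f g)"

definition mellin_sobolev_sq :: "real \<Rightarrow> real \<Rightarrow> (real \<Rightarrow> real) \<Rightarrow> ennreal" where
  "mellin_sobolev_sq s c f =
     (\<integral>\<^sup>+t. ennreal ((1 + t\<^sup>2) powr s * (cmod (mellin_real c f t))\<^sup>2) \<partial>lborel)"

(* The moment bound implies that x^(c-1) f(x) is integrable, so the Mellin transform of f is
   well defined for every member f. *)
definition mellin_sobolev_class :: "real \<Rightarrow> real \<Rightarrow> real \<Rightarrow> (real \<Rightarrow> real) set" where
  "mellin_sobolev_class c s L =
     {f. pos_density f \<and> (\<lambda>x. complex_of_real (f x)) \<in> weighted_L2 c \<and>
         pos_moment f (2 * (c - 1)) \<le> ennreal L \<and> mellin_sobolev_sq s c f \<le> ennreal L}"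

end

theory Submission
  imports Defs "HOL-Probability.Probability"
begin

text \<open>
  Under \<open>x = exp u\<close> the Mellin transform of a density \<open>f\<close> becomes the Fourier transform of
\<open>h u = exp (c * u) * f (exp u)\<close>, and the weighted norm of a function on the half-line becomes the
ordinary \<open>L\<^sup>2\<close> norm of its image. The loss of the estimator is therefore at most
\<open>1 / (2 * pi)\<close> times the squared \<open>L\<^sup>2\<close> distance between the Mellin transform of \<open>f\<close>
and the estimated transform, the empirical Mellin transform times the ridge factor
(\<open>mellin_inversion_distance\<close>).

Taking expectations frequency by frequency splits this distance into squared bias and variance
(\<open>sample_mean_risk\<close>, \<open>ridge_risk_le_bias_variance\<close>). The observation is a product of independent
variables, so its Mellin transform is the product of the transforms \<open>M f\<close> and \<open>M g\<close>, and its moment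
of order \<open>2 * (c - 1)\<close> is the product of theirs (\<open>product_law_moments\<close>).

Bias: \<open>M g\<close> times the ridge factor is \<open>1\<close> wherever \<open>1 / k \<le> cmod (M g)\<close>. Where this fails, the lower
bound on \<open>M g\<close> forces \<open>1 + t\<^sup>2\<close> to exceed a multiple of \<open>k powr (2 / \<gamma>)\<close>, and there the Sobolev bound
leaves at most a multiple of \<open>k powr (- 2 * s / \<gamma>)\<close> of the energy of \<open>M f\<close> (\<open>ridge_bias_le\<close>).

Variance: the ridge factor is bounded by \<open>k\<close>, and by the upper bound on \<open>M g\<close> it is at most a constant times
\<open>k * (\<bar>t\<bar> / T) powr (- \<gamma> * (r + 1))\<close> beyond \<open>T = k powr (1 / \<gamma>)\<close>. The assumption on \<open>r\<close> gives
\<open>\<gamma> * (r + 1) > 1\<close>, so its squared norm is of order \<open>k powr (2 + 1 / \<gamma>)\<close>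
(\<open>ridge_energy_le\<close>). The choice of \<open>k\<close> in terms of \<open>n\<close> makes \<open>k powr (2 + 1 / \<gamma>) / n\<close> and
\<open>k powr (- 2 * s / \<gamma>)\<close> the same power of \<open>n\<close>.

The analytic core is a Plancherel inequality for \<open>h - G'\<close>, with \<open>h\<close> a nonnegative integrable function and
\<open>G'\<close> the inverse transform of an integrable and square integrable \<open>G\<close>
(\<open>fourier_inversion_distance\<close>). Expanding the square reduces it to one inequality for each function:
\<open>fourier_energy_le\<close> bounds the norm of a transform from above and \<open>fourier_energy_ge\<close>, for nonnegative
functions, from below. Both follow from one identity for the energy of a
transform damped by a Gaussian (\<open>gaussian_energy\<close>): the upper bound by Schur's test, the lower bound
because the autocorrelation of a nonnegative function at shifts tending to zero recovers at least its squared
norm (\<open>autocorrelation_liminf\<close>).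
\<close>

section \<open>Fourier transforms and their Gaussian-damped energy\<close>

lemma borel_measurable_cis [measurable]: "cis \<in> borel_measurable borel"
  by (intro borel_measurable_continuous_onI continuous_on_cis continuous_on_id)

lemma borel_measurable_cnj [measurable]: "cnj \<in> borel_measurable borel"
  by (intro borel_measurable_continuous_onI continuous_on_cnj continuous_on_id)

text \<open>
  The sign and normalisation are those of the Mellin transform: positive exponent, no factor \<open>2 * pi\<close>.
\<close>

definition fourier :: "(real \<Rightarrow> complex) \<Rightarrow> real \<Rightarrow> complex" where
  "fourier F w = (\<integral>t. F t * cis (t * w) \<partial>lborel)"

lemma borel_measurable_fourier [measurable]:
  assumes [measurable]: "F \<in> borel_measurable borel"
  shows "fourier F \<in> borel_measurable borel"
  unfolding fourier_def by measurable

lemma cmod_fourier_le: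
  "cmod (fourier F w) \<le> (\<integral>t. cmod (F t) \<partial>lborel)"
  unfolding fourier_def using integral_norm_bound[of lborel "\<lambda>t. F t * cis (t * w)"] by (simp add: norm_mult)

lemma integrable_mult_cis:
  assumes F: "integrable M F" and [measurable]: "q \<in> borel_measurable M"
  shows "integrable M (\<lambda>t. F t * cis (q t))"
proof -
  have [measurable]: "F \<in> borel_measurable M" using F by auto
  show ?thesis by (rule Bochner_Integration.integrable_bound[OF F]) (auto simp: norm_mult)
qed

lemma gaussian_characteristic:
  "(\<integral>z. cis (w * z) \<partial>std_normal_distribution) = of_real (exp (- w\<^sup>2 / 2))"
  using fun_cong[OF char_std_normal_distribution, of w]
  by (simp add: char_def cis_conv_exp)

lemma integrable_tensor_cnj:
  assumes F: "integrable lborel (F :: real \<Rightarrow> complex)"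
  shows "integrable (lborel \<Otimes>\<^sub>M lborel) (\<lambda>p. F (fst p) * cnj (F (snd p)))"
proof -
  have [measurable]: "F \<in> borel_measurable borel" using F by auto
  show ?thesis
  proof (rule lborel_pair.Fubini_integrable)
    show "(\<lambda>p. F (fst p) * cnj (F (snd p))) \<in> borel_measurable (lborel \<Otimes>\<^sub>M lborel)"
      by measurable
    have "integrable lborel (\<lambda>x. norm (F x) * (\<integral>y. norm (F y) \<partial>lborel))"
      using F by auto
    then show "integrable lborel (\<lambda>x. \<integral> y. norm (F (fst (x, y)) * cnj (F (snd (x, y)))) \<partial>lborel)"
      by (simp add: norm_mult)
    show "AE x in lborel. integrable lborel (\<lambda>y. F (fst (x, y)) * cnj (F (snd (x, y))))"
      using F by auto
  qed
qed

text \<open>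
  Writing the squared modulus as a double integral over \<open>(s, t)\<close> produces the phase \<open>(s - t) * d * z\<close>; averaging it
over a standard normal \<open>z\<close> gives the normal characteristic function at \<open>d * (s - t)\<close>. The damping makes all
integrals absolutely convergent, so Fubini's theorem applies although the transform itself need not be
square integrable.
\<close>

lemma gaussian_energy:
  assumes F: "integrable lborel F"
  shows "(\<integral>z. of_real ((cmod (fourier F (d * z)))\<^sup>2) \<partial>std_normal_distribution) =
    (\<integral>p. F (fst p) * cnj (F (snd p)) * of_real (exp (- (d * (fst p - snd p))\<^sup>2 / 2)) \<partial>(lborel \<Otimes>\<^sub>M lborel))"
proof -
  have [measurable]: "F \<in> borel_measurable borel" using F by auto
  let ?N = std_normal_distribution
  let ?P = "lborel \<Otimes>\<^sub>M lborel :: (real \<times> real) measure"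
  let ?k = "\<lambda>p. F (fst p) * cnj (F (snd p))"
  interpret N: prob_space ?N by (rule prob_space_normal_density) simp
  interpret P: sigma_finite_measure ?P by (rule lborel_pair.sigma_finite_measure_axioms)
  interpret pair_sigma_finite ?P ?N ..
  have k: "integrable ?P ?k" by (rule integrable_tensor_cnj[OF F])
  have sq: "of_real ((cmod (fourier F w))\<^sup>2) = (\<integral>p. ?k p * cis ((fst p - snd p) * w) \<partial>?P)" for w
  proof -
    have i: "integrable ?P (\<lambda>p. ?k p * cis ((fst p - snd p) * w))"
      by (rule integrable_mult_cis[OF k]) measurable
    have split: "cis (w * (x - y)) = cis (x * w) * cnj (cis (y * w))" for x y
      by (simp add: cis_cnj cis_mult algebra_simps)
    have "(\<integral>p. ?k p * cis ((fst p - snd p) * w) \<partial>?P) =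
       (\<integral>x. (\<integral>y. (F x * cis (x * w)) * cnj (F y * cis (y * w)) \<partial>lborel) \<partial>lborel)"
      by (subst lborel_pair.integral_fst'[OF i, symmetric]) (simp add: split mult_ac)
    also have "\<dots> = fourier F w * (\<integral>y. cnj (F y * cis (y * w)) \<partial>lborel)"
      by (simp add: fourier_def del: complex_cnj_mult)
    also have "\<dots> = fourier F w * cnj (fourier F w)"
      by (simp only: Bochner_Integration.integral_cnj fourier_def)
    finally show ?thesis by (simp only: complex_norm_square)
  qed
  have i3: "integrable (?P \<Otimes>\<^sub>M ?N) (\<lambda>(p, z). ?k p * cis ((fst p - snd p) * (d * z)))"
  proof (rule Fubini_integrable)
    show "(\<lambda>(p, z). ?k p * cis ((fst p - snd p) * (d * z))) \<in> borel_measurable (?P \<Otimes>\<^sub>M ?N)"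
      by measurable
    show "integrable ?P (\<lambda>x. \<integral>y. norm (case (x, y) of (p, z) \<Rightarrow> ?k p * cis ((fst p - snd p) * (d * z))) \<partial>?N)"
      using integrable_norm[OF k] by (simp add: norm_mult N.prob_space[simplified])
    show "AE x in ?P. integrable ?N (\<lambda>y. case (x, y) of (p, z) \<Rightarrow> ?k p * cis ((fst p - snd p) * (d * z)))"
      by (auto intro!: integrable_mult_cis)
  qed
  have "(\<integral>z. of_real ((cmod (fourier F (d * z)))\<^sup>2) \<partial>?N) =
      (\<integral>z. (\<integral>p. ?k p * cis ((fst p - snd p) * (d * z)) \<partial>?P) \<partial>?N)"
    by (simp only: sq)
  also have "\<dots> = (\<integral>p. (\<integral>z. ?k p * cis ((fst p - snd p) * (d * z)) \<partial>?N) \<partial>?P)"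
    by (rule Fubini_integral[OF i3])
  also have "\<dots> = (\<integral>p. ?k p * (\<integral>z. cis ((d * (fst p - snd p)) * z) \<partial>?N) \<partial>?P)"
    by (simp add: mult_ac)
  finally show ?thesis by (simp add: gaussian_characteristic)
qed

lemma nn_integral_gaussian:
  assumes "d > 0"
  shows "(\<integral>\<^sup>+w. ennreal (exp (- (d * w)\<^sup>2 / 2)) \<partial>lborel) = ennreal (sqrt (2 * pi) / d)"
proof -
  have "(\<integral>\<^sup>+w. ennreal (normal_density 0 (1 / d) w) \<partial>lborel) = 1"
    using prob_space.emeasure_space_1[OF prob_space_normal_density[of "1 / d" 0]] assms
    by (simp add: emeasure_density)
  moreover have "ennreal (exp (- (d * w)\<^sup>2 / 2)) = ennreal (sqrt (2 * pi) / d) * ennreal (normal_density 0 (1 / d) w)" for w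
    using assms by (subst ennreal_mult[symmetric])
      (simp_all add: normal_density_def real_sqrt_divide real_sqrt_mult field_simps)
  ultimately show ?thesis
    by (simp add: nn_integral_cmult)
qed

text \<open>
  The same identity on the frequency scale, \<open>w = d * z\<close>. As \<open>d\<close> grows the weight increases to the constant
\<open>1 / sqrt (2 * pi)\<close>, which removes the damping.
\<close>

lemma nn_integral_gaussian_energy:
  assumes F: "integrable lborel F" and d: "d > 0"
  shows "(\<integral>\<^sup>+w. ennreal (std_normal_density (w / d)) * ennreal ((cmod (fourier F w))\<^sup>2) \<partial>lborel) =
    ennreal (d * cmod (\<integral>p. F (fst p) * cnj (F (snd p)) * of_real (exp (- (d * (fst p - snd p))\<^sup>2 / 2))
       \<partial>(lborel \<Otimes>\<^sub>M lborel)))"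
proof -
  have [measurable]: "F \<in> borel_measurable borel" using F by auto
  let ?N = std_normal_distribution
  interpret N: prob_space ?N by (rule prob_space_normal_density) simp
  let ?B = "\<integral>t. norm (F t) \<partial>lborel"
  have bd: "(cmod (fourier F w))\<^sup>2 \<le> ?B\<^sup>2" for w
    by (rule power_mono[OF cmod_fourier_le]) simp
  have int: "integrable ?N (\<lambda>z. (cmod (fourier F (d * z)))\<^sup>2)"
    by (rule N.integrable_const_bound[where B="?B\<^sup>2"]) (auto simp: bd)
  have "(\<integral>\<^sup>+w. ennreal (std_normal_density (w / d)) * ennreal ((cmod (fourier F w))\<^sup>2) \<partial>lborel) =
    ennreal d * (\<integral>\<^sup>+z. ennreal (std_normal_density z) * ennreal ((cmod (fourier F (d * z)))\<^sup>2) \<partial>lborel)"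
    using d by (subst nn_integral_real_affine[where c=d and t=0]) auto
  also have "\<dots> = ennreal d * (\<integral>\<^sup>+z. ennreal ((cmod (fourier F (d * z)))\<^sup>2) \<partial>?N)"
    by (simp add: nn_integral_density)
  also have "\<dots> = ennreal d * ennreal (\<integral>z. (cmod (fourier F (d * z)))\<^sup>2 \<partial>?N)"
    by (subst nn_integral_eq_integral[OF int]) auto
  also have "(\<integral>z. (cmod (fourier F (d * z)))\<^sup>2 \<partial>?N) =
      cmod (\<integral>z. of_real ((cmod (fourier F (d * z)))\<^sup>2) \<partial>?N)"
    by (simp del: of_real_power)
  finally show ?thesis
    unfolding gaussian_energy[OF F] using d by (simp add: ennreal_mult)
qed

text \<open>
  Schur's test: \<open>\<bar>F s * F t\<bar>\<close> is at most the mean of the two squares, and the Gaussian kernel has the same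
mass \<open>sqrt (2 * pi) / d\<close> along every row and column. The bound on the damped energy is thus uniform
in \<open>d\<close>, and Fatou's lemma removes the damping.
\<close>

lemma fourier_energy_le:
  assumes F: "integrable lborel F"
  shows "(\<integral>\<^sup>+w. ennreal ((cmod (fourier F w))\<^sup>2) \<partial>lborel) \<le>
    ennreal (2 * pi) * (\<integral>\<^sup>+t. ennreal ((cmod (F t))\<^sup>2) \<partial>lborel)"
proof -
  have [measurable]: "F \<in> borel_measurable borel" using F by auto
  let ?n = "\<integral>\<^sup>+t. ennreal ((cmod (F t))\<^sup>2) \<partial>lborel"
  have damped: "(\<integral>\<^sup>+w. ennreal (std_normal_density (w / d)) * ennreal ((cmod (fourier F w))\<^sup>2) \<partial>lborel)
      \<le> ennreal (sqrt (2 * pi)) * ?n" if d: "d > 0" for d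
  proof -
    let ?e = "\<lambda>w. exp (- (d * w)\<^sup>2 / 2)"
    let ?k = "\<lambda>p. F (fst p) * cnj (F (snd p)) * of_real (?e (fst p - snd p))"
    have [measurable]: "(\<lambda>w. ?e w) \<in> borel_measurable borel" by measurable
    have ik: "integrable (lborel \<Otimes>\<^sub>M lborel) ?k"
      by (rule Bochner_Integration.integrable_bound[OF integrable_tensor_cnj[OF F]])
         (auto simp: norm_mult intro!: mult_left_le AE_I2)
    have row: "(\<integral>\<^sup>+y. ennreal (?e (x - y)) \<partial>lborel) = ennreal (sqrt (2 * pi) / d)"
      and col: "(\<integral>\<^sup>+y. ennreal (?e (y - x)) \<partial>lborel) = ennreal (sqrt (2 * pi) / d)" for x
    proof -
      show "(\<integral>\<^sup>+y. ennreal (?e (x - y)) \<partial>lborel) = ennreal (sqrt (2 * pi) / d)"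
        using nn_integral_gaussian[OF d] nn_integral_real_affine[where c="-1" and t=x and f="\<lambda>w. ennreal (?e w)"]
        by simp
      show "(\<integral>\<^sup>+y. ennreal (?e (y - x)) \<partial>lborel) = ennreal (sqrt (2 * pi) / d)"
        using nn_integral_gaussian[OF d] nn_integral_real_affine[where c="1" and t="-x" and f="\<lambda>w. ennreal (?e w)"]
        by simp
    qed
    have "ennreal (cmod (\<integral>p. ?k p \<partial>(lborel \<Otimes>\<^sub>M lborel)))
        \<le> (\<integral>\<^sup>+p. ennreal (cmod (?k p)) \<partial>(lborel \<Otimes>\<^sub>M lborel))"
      by (rule integral_norm_bound_ennreal[OF ik])
    also have "\<dots> \<le> (\<integral>\<^sup>+p. ennreal ((cmod (F (fst p)))\<^sup>2 / 2) * ennreal (?e (fst p - snd p)) +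
        ennreal ((cmod (F (snd p)))\<^sup>2 / 2) * ennreal (?e (fst p - snd p)) \<partial>(lborel \<Otimes>\<^sub>M lborel))"
    proof (intro nn_integral_mono)
      fix p :: "real \<times> real"
      have "cmod (F (fst p)) * cmod (F (snd p)) \<le> (cmod (F (fst p)))\<^sup>2 / 2 + (cmod (F (snd p)))\<^sup>2 / 2"
        using sum_squares_bound[of "cmod (F (fst p))" "cmod (F (snd p))"] by simp
      then have "cmod (?k p) \<le> ((cmod (F (fst p)))\<^sup>2 / 2 + (cmod (F (snd p)))\<^sup>2 / 2) * ?e (fst p - snd p)"
        by (simp add: norm_mult mult_right_mono)
      then show "ennreal (cmod (?k p)) \<le> ennreal ((cmod (F (fst p)))\<^sup>2 / 2) * ennreal (?e (fst p - snd p)) +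
        ennreal ((cmod (F (snd p)))\<^sup>2 / 2) * ennreal (?e (fst p - snd p))"
        by (simp add: distrib_right flip: ennreal_mult ennreal_plus)
    qed
    also have "\<dots> = (\<integral>\<^sup>+x. ennreal ((cmod (F x))\<^sup>2 / 2) * (\<integral>\<^sup>+y. ennreal (?e (x - y)) \<partial>lborel) \<partial>lborel) +
        (\<integral>\<^sup>+y. ennreal ((cmod (F y))\<^sup>2 / 2) * (\<integral>\<^sup>+x. ennreal (?e (x - y)) \<partial>lborel) \<partial>lborel)"
      by (subst nn_integral_add)
         (simp_all add: nn_integral_cmult lborel_pair.nn_integral_snd[symmetric, of "\<lambda>p. ennreal ((cmod (F (snd p)))\<^sup>2 / 2) * _ p"]
           lborel.nn_integral_fst[symmetric, of "\<lambda>p. ennreal ((cmod (F (fst p)))\<^sup>2 / 2) * _ p"])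
    also have "\<dots> = ennreal (sqrt (2 * pi) / d) * ?n"
    proof -
      have half: "ennreal ((cmod (F x))\<^sup>2 / 2) * a + ennreal ((cmod (F x))\<^sup>2 / 2) * a = a * ennreal ((cmod (F x))\<^sup>2)" for x a
        by (simp add: mult.commute flip: distrib_left ennreal_plus)
      show ?thesis
        unfolding row col by (subst nn_integral_add[symmetric]) (simp_all only: half, simp_all add: nn_integral_cmult)
    qed
    finally have "ennreal d * ennreal (cmod (\<integral>p. ?k p \<partial>(lborel \<Otimes>\<^sub>M lborel)))
        \<le> ennreal d * (ennreal (sqrt (2 * pi) / d) * ?n)"
      by (rule mult_left_mono) simp
    also have "\<dots> = ennreal (sqrt (2 * pi)) * ?n"
      using d by (simp add: mult.assoc[symmetric] flip: ennreal_mult)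
    finally show ?thesis
      unfolding nn_integral_gaussian_energy[OF F d] using d by (simp add: ennreal_mult)
  qed
  have lim: "(\<lambda>i. ennreal (std_normal_density (w / Suc i)) * ennreal ((cmod (fourier F w))\<^sup>2))
      \<longlonglongrightarrow> ennreal (1 / sqrt (2 * pi)) * ennreal ((cmod (fourier F w))\<^sup>2)" for w
  proof -
    have "(\<lambda>i. w / real (Suc i)) \<longlonglongrightarrow> 0"
      by real_asymp
    then have "(\<lambda>i. (1 / sqrt (2 * pi)) * exp (- (w / Suc i)\<^sup>2 / 2)) \<longlonglongrightarrow> (1 / sqrt (2 * pi)) * exp (- 0\<^sup>2 / 2)"
      by (intro tendsto_intros) auto
    then show ?thesis
      unfolding std_normal_density_def
      by (intro tendsto_mult_ennreal tendsto_ennrealI tendsto_const) auto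
  qed
  have "ennreal (1 / sqrt (2 * pi)) * (\<integral>\<^sup>+w. ennreal ((cmod (fourier F w))\<^sup>2) \<partial>lborel) =
     (\<integral>\<^sup>+w. liminf (\<lambda>i. ennreal (std_normal_density (w / Suc i)) * ennreal ((cmod (fourier F w))\<^sup>2)) \<partial>lborel)"
    using lim_imp_Liminf[OF _ lim] by (simp add: nn_integral_cmult)
  also have "\<dots> \<le> liminf (\<lambda>i. \<integral>\<^sup>+w. ennreal (std_normal_density (w / Suc i)) * ennreal ((cmod (fourier F w))\<^sup>2) \<partial>lborel)"
    by (rule nn_integral_liminf) simp
  also have "\<dots> \<le> ennreal (sqrt (2 * pi)) * ?n"
    using damped by (intro Liminf_le) (auto intro!: always_eventually)
  finally have "ennreal (sqrt (2 * pi)) * (ennreal (1 / sqrt (2 * pi)) * (\<integral>\<^sup>+w. ennreal ((cmod (fourier F w))\<^sup>2) \<partial>lborel))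
      \<le> ennreal (sqrt (2 * pi)) * (ennreal (sqrt (2 * pi)) * ?n)"
    by (rule mult_left_mono) simp
  then show ?thesis
    by (simp add: mult.assoc[symmetric] flip: ennreal_mult)
qed

section \<open>Autocorrelation at small shifts\<close>

text \<open>
  By inclusion-exclusion it suffices to treat the union of \<open>K\<close> with its translate. The indicator of that union
tends pointwise to the one of \<open>K\<close>, because a point outside the closed set \<open>K\<close> is eventually not moved into it,
and boundedness of \<open>K\<close> supplies a dominating function.
\<close>

lemma autocorrelation_compact:
  fixes K :: "real set"
  assumes K: "compact K" and t: "t \<longlonglongrightarrow> (0::real)"
  shows "(\<lambda>i. \<integral>\<^sup>+u. indicator K u * indicator K (u + t i) \<partial>lborel) \<longlonglongrightarrow> emeasure lborel K"
proof -
  let ?I = "\<lambda>u. indicator K u :: real"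
  have [measurable]: "K \<in> sets borel" using K by (simp add: compact_imp_closed)
  have fin: "emeasure lborel K < \<infinity>" by (rule emeasure_bounded_finite[OF compact_imp_bounded[OF K]])
  obtain R where R: "\<And>x. x \<in> K \<Longrightarrow> \<bar>x\<bar> \<le> R"
    using compact_imp_bounded[OF K] by (auto simp: bounded_iff)
  obtain T where T: "\<And>i. \<bar>t i\<bar> \<le> T"
    using convergent_imp_bounded[OF t] by (auto simp: bounded_iff)
  have iI: "integrable lborel ?I" using fin by simp
  have iS: "integrable lborel (\<lambda>u. ?I (u + s))" for s
    using lborel_integrable_real_affine[OF iI, of 1 s] by (simp add: add.commute)
  have eS: "(\<integral>u. ?I (u + s) \<partial>lborel) = measure lborel K" for s
    using lborel_integral_real_affine[of 1 ?I s] by (simp add: add.commute)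
  have iP: "integrable lborel (\<lambda>u. ?I u * ?I (u + s))" for s
    by (rule Bochner_Integration.integrable_bound[OF iI]) (auto simp: indicator_def)
  have conv: "(\<lambda>i. \<integral>u. ?I u + ?I (u + t i) - ?I u * ?I (u + t i) \<partial>lborel) \<longlonglongrightarrow> (\<integral>u. ?I u \<partial>lborel)"
  proof (rule integral_dominated_convergence)
    show "integrable lborel (\<lambda>u. indicator {-(R + T)..R + T} u :: real)"
      by (rule integrable_real_indicator) (use emeasure_bounded_finite[of "{-(R + T)..R + T}"] in simp_all)
    show "AE u in lborel. norm (?I u + ?I (u + t i) - ?I u * ?I (u + t i)) \<le> indicator {-(R + T)..R + T} u" for i
    proof (rule AE_I2)
      fix u
      show "norm (?I u + ?I (u + t i) - ?I u * ?I (u + t i)) \<le> indicator {-(R + T)..R + T} u"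
        using R[of u] R[of "u + t i"] T[of i] by (auto simp: indicator_def)
    qed
    show "AE u in lborel. (\<lambda>i. ?I u + ?I (u + t i) - ?I u * ?I (u + t i)) \<longlonglongrightarrow> ?I u"
    proof (rule AE_I2)
      fix u
      show "(\<lambda>i. ?I u + ?I (u + t i) - ?I u * ?I (u + t i)) \<longlonglongrightarrow> ?I u"
      proof (cases "u \<in> K")
        case False
        have "(\<lambda>i. u + t i) \<longlonglongrightarrow> u + 0" by (intro tendsto_intros t)
        moreover have "open (- K)" using K by (simp add: compact_imp_closed open_Compl)
        ultimately have "eventually (\<lambda>i. u + t i \<in> - K) sequentially"
          by (rule topological_tendstoD) (use False in simp)
        then show ?thesis
          using False by (intro tendsto_eventually) (auto elim!: eventually_mono)
      qed simp
    qed
  qed measurable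
  have "(\<lambda>i. 2 * measure lborel K - (\<integral>u. ?I u + ?I (u + t i) - ?I u * ?I (u + t i) \<partial>lborel))
      \<longlonglongrightarrow> 2 * measure lborel K - (\<integral>u. ?I u \<partial>lborel)"
    by (intro tendsto_intros conv)
  then have "(\<lambda>i. \<integral>u. ?I u * ?I (u + t i) \<partial>lborel) \<longlonglongrightarrow> measure lborel K"
    using iI iS iP by (simp add: eS)
  then have "(\<lambda>i. ennreal (\<integral>u. ?I u * ?I (u + t i) \<partial>lborel)) \<longlonglongrightarrow> ennreal (measure lborel K)"
    by (rule tendsto_ennrealI)
  moreover have "ennreal (\<integral>u. ?I u * ?I (u + s) \<partial>lborel) = (\<integral>\<^sup>+u. indicator K u * indicator K (u + s) \<partial>lborel)" for s
    by (subst nn_integral_eq_integral[OF iP, symmetric]) (auto simp: indicator_def intro!: nn_integral_cong)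
  moreover have "ennreal (measure lborel K) = emeasure lborel K"
    using fin by (simp add: emeasure_eq_ennreal_measure)
  ultimately show ?thesis by simp
qed

text \<open>
  Inner regularity by compact sets passes the lower bound from compact to Borel sets. It is applied to
Lebesgue measure restricted to bounded intervals, which makes the measure finite.
\<close>

lemma autocorrelation_borel_set:
  fixes E :: "real set"
  assumes E [measurable]: "E \<in> sets borel" and t: "t \<longlonglongrightarrow> (0::real)"
  shows "emeasure lborel E \<le> liminf (\<lambda>i. \<integral>\<^sup>+u. indicator E u * indicator E (u + t i) \<partial>lborel)"
    (is "_ \<le> ?L")
proof -
  have compact_le: "emeasure lborel K \<le> ?L" if "compact K" "K \<subseteq> E" for K
  proof -
    have "emeasure lborel K = liminf (\<lambda>i. \<integral>\<^sup>+u. indicator K u * indicator K (u + t i) \<partial>lborel)"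
      using lim_imp_Liminf[OF _ autocorrelation_compact[OF that(1) t]] by simp
    also have "\<dots> \<le> ?L"
      using that(2) by (intro Liminf_mono always_eventually allI nn_integral_mono) (auto simp: indicator_def)
    finally show ?thesis .
  qed
  have bounded_le: "emeasure lborel (E \<inter> {- real m..real m}) \<le> ?L" for m
  proof -
    let ?M = "density lborel (indicator {- real m..real m})"
    have em: "emeasure ?M A = emeasure lborel (A \<inter> {- real m..real m})" if "A \<in> sets borel" for A
    proof -
      have "emeasure ?M A = (\<integral>\<^sup>+x. indicator {- real m..real m} x * indicator A x \<partial>lborel)"
        using that by (intro emeasure_density) auto
      also have "\<dots> = (\<integral>\<^sup>+x. indicator (A \<inter> {- real m..real m}) x \<partial>lborel)"
        by (intro nn_integral_cong) (auto simp: indicator_def)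
      finally show ?thesis using that by simp
    qed
    have "emeasure ?M E = (SUP K \<in> {K. K \<subseteq> E \<and> compact K}. emeasure ?M K)"
      by (rule inner_regular) (simp_all add: em)
    also have "\<dots> \<le> ?L"
      by (rule SUP_least) (auto simp: em compact_imp_closed intro!: compact_le compact_Int_closed)
    finally show ?thesis by (simp add: em)
  qed
  have "(\<lambda>m. emeasure lborel (E \<inter> {- real m..real m})) \<longlonglongrightarrow> emeasure lborel (\<Union>m. E \<inter> {- real m..real m})"
    by (rule Lim_emeasure_incseq) (auto simp: incseq_def)
  moreover have "(\<Union>m. E \<inter> {- real m..real m}) = E"
  proof -
    have "\<exists>m. - real m \<le> x \<and> x \<le> real m" for x
      using real_arch_simple[of "\<bar>x\<bar>"] by (metis abs_le_iff minus_le_iff)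
    then show ?thesis by auto
  qed
  ultimately have "(\<lambda>m. emeasure lborel (E \<inter> {- real m..real m})) \<longlonglongrightarrow> emeasure lborel E" by simp
  then show ?thesis
    by (rule LIMSEQ_le_const2) (use bounded_le in auto)
qed

text \<open>
  For a simple function below \<open>h\<close>, only the products of equal level sets are kept; the others are nonnegative. Fatou's
lemma for the counting measure on the finitely many values expresses that the lower limit is superadditive.
Monotone convergence then reaches \<open>h\<close>.
\<close>

lemma autocorrelation_liminf:
  fixes h :: "real \<Rightarrow> ennreal"
  assumes [measurable]: "h \<in> borel_measurable borel" and t: "t \<longlonglongrightarrow> (0::real)"
  shows "(\<integral>\<^sup>+u. h u * h u \<partial>lborel) \<le> liminf (\<lambda>i. \<integral>\<^sup>+u. h u * h (u + t i) \<partial>lborel)" (is "_ \<le> ?L")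
proof -
  have simple_le: "(\<integral>\<^sup>+u. s u * s u \<partial>lborel) \<le> ?L" if s: "simple_function lborel s" and le: "s \<le> h" for s
  proof -
    let ?C = "range s"
    let ?E = "\<lambda>c. s -` {c}"
    have finC: "finite ?C" using s by (simp add: simple_function_def)
    have [measurable]: "s \<in> borel_measurable borel"
      using borel_measurable_simple_function[OF s] by simp
    have [measurable]: "?E c \<in> sets borel" for c
      using measurable_sets[of s borel borel "{c}"] by simp
    have single: "(\<Sum>c\<in>?C. c * c * indicator (?E c) u * indicator (?E c) v) \<le> s u * s v" for u v
    proof -
      have "(\<Sum>c\<in>?C. c * c * indicator (?E c) u * indicator (?E c) v) =
          (\<Sum>c\<in>?C. if c = s u then s u * s u * indicator (?E (s u)) v else 0)"
        by (intro sum.cong) (auto simp: indicator_def)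
      also have "\<dots> = s u * s u * indicator (?E (s u)) v"
        using finC by simp
      finally show ?thesis by (auto simp: indicator_def)
    qed
    have diag: "s u * s u = (\<Sum>c\<in>?C. c * c * indicator (?E c) u)" for u
    proof -
      have "(\<Sum>c\<in>?C. c * c * indicator (?E c) u) = (\<Sum>c\<in>?C. if c = s u then s u * s u else 0)"
        by (intro sum.cong) (auto simp: indicator_def)
      then show ?thesis using finC by simp
    qed
    have "(\<integral>\<^sup>+u. s u * s u \<partial>lborel) = (\<Sum>c\<in>?C. c * c * emeasure lborel (?E c))"
      unfolding diag by (subst nn_integral_sum) (auto simp: nn_integral_cmult)
    also have "\<dots> \<le> (\<Sum>c\<in>?C. liminf (\<lambda>i. c * c * (\<integral>\<^sup>+u. indicator (?E c) u * indicator (?E c) (u + t i) \<partial>lborel)))"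
    proof (intro sum_mono)
      fix c
      have "c * c * emeasure lborel (?E c) \<le> c * c * liminf (\<lambda>i. \<integral>\<^sup>+u. indicator (?E c) u * indicator (?E c) (u + t i) \<partial>lborel)"
        by (intro mult_left_mono autocorrelation_borel_set t) auto
      also have "\<dots> \<le> liminf (\<lambda>i. c * c * (\<integral>\<^sup>+u. indicator (?E c) u * indicator (?E c) (u + t i) \<partial>lborel))"
        unfolding liminf_SUP_INF SUP_mult_left_ennreal
        by (intro SUP_mono exI conjI bexI INF_greatest mult_left_mono INF_lower) auto
      finally show "c * c * emeasure lborel (?E c) \<le> \<dots>" .
    qed
    also have "\<dots> = (\<integral>\<^sup>+c. liminf (\<lambda>i. c * c * (\<integral>\<^sup>+u. indicator (?E c) u * indicator (?E c) (u + t i) \<partial>lborel)) \<partial>count_space ?C)"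
      by (rule nn_integral_count_space_finite[OF finC, symmetric])
    also have "\<dots> \<le> liminf (\<lambda>i. \<integral>\<^sup>+c. c * c * (\<integral>\<^sup>+u. indicator (?E c) u * indicator (?E c) (u + t i) \<partial>lborel) \<partial>count_space ?C)"
      by (rule nn_integral_liminf) simp
    also have "\<dots> \<le> ?L"
    proof (intro Liminf_mono always_eventually allI)
      fix i
      have "(\<integral>\<^sup>+c. c * c * (\<integral>\<^sup>+u. indicator (?E c) u * indicator (?E c) (u + t i) \<partial>lborel) \<partial>count_space ?C) =
          (\<integral>\<^sup>+u. (\<Sum>c\<in>?C. c * c * indicator (?E c) u * indicator (?E c) (u + t i)) \<partial>lborel)"
        by (subst nn_integral_sum) (auto simp: nn_integral_count_space_finite[OF finC] nn_integral_cmult mult.assoc)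
      also have "\<dots> \<le> (\<integral>\<^sup>+u. h u * h (u + t i) \<partial>lborel)"
        using le by (intro nn_integral_mono order_trans[OF single] mult_mono) (auto simp: le_fun_def)
      finally show "(\<integral>\<^sup>+c. c * c * (\<integral>\<^sup>+u. indicator (?E c) u * indicator (?E c) (u + t i) \<partial>lborel) \<partial>count_space ?C)
         \<le> (\<integral>\<^sup>+u. h u * h (u + t i) \<partial>lborel)" .
    qed
    finally show ?thesis .
  qed
  obtain F where F: "incseq F" "\<And>i. simple_function lborel (F i)" "\<And>x. (SUP i. F i x) = h x"
    by (rule borel_measurable_implies_simple_function_sequence'[of h lborel]) (simp, blast)
  have [measurable]: "F i \<in> borel_measurable borel" for i
    using borel_measurable_simple_function[OF F(2)] by simp
  have Fle: "F i \<le> h" for i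
    unfolding le_fun_def F(3)[symmetric] by (auto intro: SUP_upper)
  have "(\<lambda>i. \<integral>\<^sup>+u. F i u * F i u \<partial>lborel) \<longlonglongrightarrow> (\<integral>\<^sup>+u. h u * h u \<partial>lborel)"
  proof (rule nn_integral_LIMSEQ)
    show "incseq (\<lambda>i u. F i u * F i u)"
      using F(1) by (auto simp: incseq_def le_fun_def intro!: mult_mono)
    show "(\<lambda>i. F i u * F i u) \<longlonglongrightarrow> h u * h u" for u
    proof -
      have "(\<lambda>i. F i u) \<longlonglongrightarrow> h u"
        using LIMSEQ_SUP[of "\<lambda>i. F i u"] F(1,3) by (auto simp: incseq_def le_fun_def)
      then show ?thesis
        by (intro tendsto_mult_ennreal) auto
    qed
  qed measurable
  then show ?thesis
    by (rule LIMSEQ_le_const2) (use simple_le[OF F(2) Fle] in auto)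
qed

section \<open>Plancherel inequalities\<close>

text \<open>
  The other side of the damped energy identity is \<open>d\<close> times the integral of the autocorrelation \<open>B\<close> of \<open>h\<close> against a
Gaussian of width \<open>1 / d\<close>. Rescaling turns it into an integral of \<open>B (z / d)\<close> against a fixed Gaussian, where
Fatou's lemma and the behaviour of \<open>B\<close> at small shifts give the bound. Nonnegativity makes the lower limit
sufficient.
\<close>

lemma fourier_energy_ge:
  fixes h :: "real \<Rightarrow> real"
  assumes h: "integrable lborel h" and nonneg: "\<And>u. 0 \<le> h u"
  shows "ennreal (2 * pi) * (\<integral>\<^sup>+u. ennreal ((h u)\<^sup>2) \<partial>lborel) \<le>
    (\<integral>\<^sup>+w. ennreal ((cmod (fourier (\<lambda>u. of_real (h u)) w))\<^sup>2) \<partial>lborel)"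
proof -
  have [measurable]: "h \<in> borel_measurable borel" using h by auto
  let ?F = "\<lambda>u. complex_of_real (h u)"
  let ?H = "\<integral>\<^sup>+w. ennreal ((cmod (fourier ?F w))\<^sup>2) \<partial>lborel"
  let ?e = "\<lambda>w::real. exp (- w\<^sup>2 / 2)"
  define B where "B = (\<lambda>w. \<integral>\<^sup>+u. ennreal (h u) * ennreal (h (u + w)) \<partial>lborel)"
  have [measurable]: "B \<in> borel_measurable borel" unfolding B_def by measurable
  have F: "integrable lborel ?F" using h by simp
  have damped: "(\<integral>\<^sup>+z. ennreal (?e z) * B (z / d) \<partial>lborel) \<le> ennreal (1 / sqrt (2 * pi)) * ?H" if d: "d > 0" for d
  proof -
    let ?r = "\<lambda>p. h (fst p) * h (snd p) * ?e (d * (fst p - snd p))"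
    let ?P = "lborel \<Otimes>\<^sub>M lborel :: (real \<times> real) measure"
    have ik: "integrable ?P (\<lambda>p. ?F (fst p) * cnj (?F (snd p)))"
      by (rule integrable_tensor_cnj[OF F])
    have ir: "integrable ?P ?r"
      by (rule Bochner_Integration.integrable_bound[OF ik])
         (auto simp: norm_mult abs_mult intro!: mult_left_le AE_I2)
    have "(\<integral>p. ?F (fst p) * cnj (?F (snd p)) * of_real (exp (- (d * (fst p - snd p))\<^sup>2 / 2)) \<partial>?P) = of_real (\<integral>p. ?r p \<partial>?P)"
      by (subst integral_complex_of_real[symmetric]) (auto intro!: Bochner_Integration.integral_cong)
    then have "ennreal (cmod (\<integral>p. ?F (fst p) * cnj (?F (snd p)) * of_real (exp (- (d * (fst p - snd p))\<^sup>2 / 2)) \<partial>?P))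
       = ennreal (\<integral>p. ?r p \<partial>?P)"
      by (simp only: norm_of_real) (auto intro!: arg_cong[where f=ennreal] abs_of_nonneg integral_nonneg_AE simp: nonneg)
    also have "\<dots> = (\<integral>\<^sup>+p. ennreal (?r p) \<partial>?P)"
      by (rule nn_integral_eq_integral[OF ir, symmetric]) (simp add: nonneg)
    also have "\<dots> = (\<integral>\<^sup>+x. (\<integral>\<^sup>+y. ennreal (?r (x, y)) \<partial>lborel) \<partial>lborel)"
      by (rule lborel.nn_integral_fst[symmetric, of "\<lambda>p. ennreal (?r p)"]) measurable
    also have "\<dots> = (\<integral>\<^sup>+x. (\<integral>\<^sup>+w. ennreal (?r (x, x + w)) \<partial>lborel) \<partial>lborel)"
    proof (rule nn_integral_cong)
      fix x :: real
      show "(\<integral>\<^sup>+y. ennreal (?r (x, y)) \<partial>lborel) = (\<integral>\<^sup>+w. ennreal (?r (x, x + w)) \<partial>lborel)"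
        by (subst nn_integral_real_affine[where c=1 and t=x]) auto
    qed
    also have "\<dots> = (\<integral>\<^sup>+w. (\<integral>\<^sup>+x. ennreal (?r (x, x + w)) \<partial>lborel) \<partial>lborel)"
      by (rule lborel_pair.Fubini'[symmetric]) measurable
    also have "\<dots> = (\<integral>\<^sup>+w. ennreal (?e (d * w)) * B w \<partial>lborel)"
      unfolding B_def
      by (intro nn_integral_cong, subst nn_integral_cmult[symmetric])
         (auto intro!: nn_integral_cong simp: nonneg ennreal_mult mult_ac)
    also have "\<dots> = ennreal (1 / d) * (\<integral>\<^sup>+z. ennreal (?e z) * B (z / d) \<partial>lborel)"
      using d by (subst nn_integral_real_affine[where c="1 / d" and t=0]) auto
    finally have "ennreal d * ennreal (cmod (\<integral>p. ?F (fst p) * cnj (?F (snd p)) * of_real (exp (- (d * (fst p - snd p))\<^sup>2 / 2)) \<partial>?P))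
        = (\<integral>\<^sup>+z. ennreal (?e z) * B (z / d) \<partial>lborel)"
      using d by (simp add: mult.assoc[symmetric] flip: ennreal_mult)
    then have "(\<integral>\<^sup>+z. ennreal (?e z) * B (z / d) \<partial>lborel) =
        (\<integral>\<^sup>+w. ennreal (std_normal_density (w / d)) * ennreal ((cmod (fourier ?F w))\<^sup>2) \<partial>lborel)"
      unfolding nn_integral_gaussian_energy[OF F d] using d by (simp add: ennreal_mult)
    also have "\<dots> \<le> (\<integral>\<^sup>+w. ennreal (1 / sqrt (2 * pi)) * ennreal ((cmod (fourier ?F w))\<^sup>2) \<partial>lborel)"
    proof (intro nn_integral_mono mult_right_mono ennreal_leI)
      fix w
      have "?e (w / d) \<le> 1" by simp
      then show "std_normal_density (w / d) \<le> 1 / sqrt (2 * pi)"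
        unfolding std_normal_density_def by (intro mult_left_le) auto
    qed auto
    finally show ?thesis by (simp add: nn_integral_cmult)
  qed
  have "(\<integral>\<^sup>+u. ennreal ((h u)\<^sup>2) \<partial>lborel) = (\<integral>\<^sup>+u. ennreal (h u) * ennreal (h u) \<partial>lborel)"
    by (simp add: power2_eq_square ennreal_mult nonneg)
  then have B_liminf: "(\<integral>\<^sup>+u. ennreal ((h u)\<^sup>2) \<partial>lborel) \<le> liminf (\<lambda>i. B (z / Suc i))" for z
    unfolding B_def by (simp only:) (rule autocorrelation_liminf, measurable, real_asymp)
  have "ennreal (sqrt (2 * pi)) * (\<integral>\<^sup>+u. ennreal ((h u)\<^sup>2) \<partial>lborel) =
      (\<integral>\<^sup>+z. ennreal (?e z) * (\<integral>\<^sup>+u. ennreal ((h u)\<^sup>2) \<partial>lborel) \<partial>lborel)"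
    using nn_integral_gaussian[of 1] by (simp add: nn_integral_multc)
  also have "\<dots> \<le> (\<integral>\<^sup>+z. liminf (\<lambda>i. ennreal (?e z) * B (z / Suc i)) \<partial>lborel)"
  proof (intro nn_integral_mono)
    fix z
    have "ennreal (?e z) * (\<integral>\<^sup>+u. ennreal ((h u)\<^sup>2) \<partial>lborel) \<le> ennreal (?e z) * liminf (\<lambda>i. B (z / Suc i))"
      by (intro mult_left_mono B_liminf) simp
    also have "\<dots> \<le> liminf (\<lambda>i. ennreal (?e z) * B (z / Suc i))"
      unfolding liminf_SUP_INF SUP_mult_left_ennreal
      by (intro SUP_mono exI conjI bexI INF_greatest mult_left_mono INF_lower) auto
    finally show "ennreal (?e z) * (\<integral>\<^sup>+u. ennreal ((h u)\<^sup>2) \<partial>lborel) \<le> \<dots>" .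
  qed
  also have "\<dots> \<le> liminf (\<lambda>i. \<integral>\<^sup>+z. ennreal (?e z) * B (z / Suc i) \<partial>lborel)"
    by (rule nn_integral_liminf) measurable
  also have "\<dots> \<le> ennreal (1 / sqrt (2 * pi)) * ?H"
    using damped by (intro Liminf_le) (auto intro!: always_eventually)
  finally have "ennreal (sqrt (2 * pi)) * (ennreal (sqrt (2 * pi)) * (\<integral>\<^sup>+u. ennreal ((h u)\<^sup>2) \<partial>lborel))
      \<le> ennreal (sqrt (2 * pi)) * (ennreal (1 / sqrt (2 * pi)) * ?H)"
    by (rule mult_left_mono) simp
  then show ?thesis
    by (simp add: mult.assoc[symmetric] flip: ennreal_mult)
qed

lemma cmod_diff_power2: "(cmod (a - b))\<^sup>2 = (cmod a)\<^sup>2 - 2 * Re (a * cnj b) + (cmod b)\<^sup>2"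
  unfolding cmod_power2 by (simp add: power2_eq_square algebra_simps)

lemma integrable_mult_bounded:
  fixes F G :: "real \<Rightarrow> complex"
  assumes F: "integrable lborel F" and [measurable]: "G \<in> borel_measurable borel" and G: "\<And>x. cmod (G x) \<le> B"
  shows "integrable lborel (\<lambda>x. F x * G x)"
proof -
  have [measurable]: "F \<in> borel_measurable borel" using F by auto
  have "integrable lborel (\<lambda>x. F x * of_real B)" using F by simp
  then show ?thesis
    by (rule Bochner_Integration.integrable_bound)
       (auto simp: norm_mult intro!: mult_left_mono order_trans[OF G])
qed

text \<open>
  Both sides are the double integral of \<open>F u * cnj (G t) * cis (u * t)\<close>.
\<close>

lemma fourier_parseval:
  assumes F: "integrable lborel F" and G: "integrable lborel G"
  shows "(\<integral>u. F u * cnj (fourier G (- u)) \<partial>lborel) = (\<integral>t. fourier F t * cnj (G t) \<partial>lborel)"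
proof -
  have [measurable]: "F \<in> borel_measurable borel" "G \<in> borel_measurable borel" using F G by auto
  have i: "integrable (lborel \<Otimes>\<^sub>M lborel) (\<lambda>(u, t). F u * cnj (G t) * cis (u * t))"
  proof (rule lborel_pair.Fubini_integrable)
    show "(\<lambda>(u, t). F u * cnj (G t) * cis (u * t)) \<in> borel_measurable (lborel \<Otimes>\<^sub>M lborel)" by measurable
    have "integrable lborel (\<lambda>x. norm (F x) * (\<integral>y. norm (G y) \<partial>lborel))"
      using F by auto
    then show "integrable lborel (\<lambda>x. \<integral>y. norm (case (x, y) of (u, t) \<Rightarrow> F u * cnj (G t) * cis (u * t)) \<partial>lborel)"
      by (simp add: norm_mult)
    show "AE x in lborel. integrable lborel (\<lambda>y. case (x, y) of (u, t) \<Rightarrow> F u * cnj (G t) * cis (u * t))"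
      using G by (auto intro!: integrable_mult_cis)
  qed
  have "(\<integral>u. F u * cnj (fourier G (- u)) \<partial>lborel) = (\<integral>u. (\<integral>t. F u * cnj (G t) * cis (u * t) \<partial>lborel) \<partial>lborel)"
    by (simp add: fourier_def cis_cnj mult_ac flip: Bochner_Integration.integral_cnj)
  also have "\<dots> = (\<integral>t. (\<integral>u. F u * cnj (G t) * cis (u * t) \<partial>lborel) \<partial>lborel)"
    by (rule lborel_pair.Fubini_integral[OF i, symmetric])
  also have "\<dots> = (\<integral>t. (\<integral>u. F u * cis (u * t) * cnj (G t) \<partial>lborel) \<partial>lborel)"
    by (simp add: mult_ac)
  finally show ?thesis by (simp add: fourier_def)
qed

text \<open>
  In \<open>\<parallel>h\<parallel>\<^sup>2 - 2 * Re \<langle>h, G'\<rangle> + \<parallel>G'\<parallel>\<^sup>2\<close>, with \<open>G'\<close> the inverse transform of \<open>G\<close>, the squares are bounded by the two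
energy inequalities and the cross term is exact by Parseval's formula.
\<close>

lemma fourier_inversion_distance:
  fixes h :: "real \<Rightarrow> real"
  assumes h: "integrable lborel h" and nonneg: "\<And>u. 0 \<le> h u"
    and hhat: "(\<integral>\<^sup>+w. ennreal ((cmod (fourier (\<lambda>u. of_real (h u)) w))\<^sup>2) \<partial>lborel) < \<infinity>"
    and G: "integrable lborel G" and G2: "integrable lborel (\<lambda>t. (cmod (G t))\<^sup>2)"
  shows "(\<integral>\<^sup>+u. ennreal ((cmod (of_real (h u) - of_real (1 / (2 * pi)) * fourier G (- u)))\<^sup>2) \<partial>lborel) \<le>
    ennreal (1 / (2 * pi)) * (\<integral>\<^sup>+t. ennreal ((cmod (fourier (\<lambda>u. of_real (h u)) t - G t))\<^sup>2) \<partial>lborel)"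
proof -
  have [measurable]: "h \<in> borel_measurable borel" "G \<in> borel_measurable borel" using h G by auto
  let ?F = "\<lambda>u. complex_of_real (h u)"
  let ?H = "fourier ?F"
  let ?G = "\<lambda>u. of_real (1 / (2 * pi)) * fourier G (- u)"
  have F: "integrable lborel ?F" using h by simp
  have iH: "integrable lborel (\<lambda>t. (cmod (?H t))\<^sup>2)"
    using hhat by (intro integrableI_bounded) auto
  have h_le: "ennreal (2 * pi) * (\<integral>\<^sup>+u. ennreal ((h u)\<^sup>2) \<partial>lborel) \<le> ennreal (\<integral>t. (cmod (?H t))\<^sup>2 \<partial>lborel)"
    using fourier_energy_ge[OF h nonneg] by (simp add: nn_integral_eq_integral[OF iH])
  then have "ennreal (2 * pi) * (\<integral>\<^sup>+u. ennreal ((h u)\<^sup>2) \<partial>lborel) < \<infinity>"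
    by (rule le_less_trans) simp
  then have "(\<integral>\<^sup>+u. ennreal ((h u)\<^sup>2) \<partial>lborel) < \<infinity>"
    by (auto simp: ennreal_mult_less_top)
  then have ih: "integrable lborel (\<lambda>u. (h u)\<^sup>2)"
    by (intro integrableI_bounded) auto
  have h_le': "(\<integral>u. (h u)\<^sup>2 \<partial>lborel) \<le> 1 / (2 * pi) * (\<integral>t. (cmod (?H t))\<^sup>2 \<partial>lborel)"
    using h_le by (simp add: nn_integral_eq_integral[OF ih] field_simps flip: ennreal_mult')
  have G_refl: "(\<integral>\<^sup>+u. ennreal ((cmod (fourier G (- u)))\<^sup>2) \<partial>lborel) \<le> ennreal (2 * pi * (\<integral>t. (cmod (G t))\<^sup>2 \<partial>lborel))"
    using fourier_energy_le[OF G] nn_integral_real_affine[of "\<lambda>w. ennreal ((cmod (fourier G w))\<^sup>2)" "-1" 0]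
    by (simp add: nn_integral_eq_integral[OF G2] ennreal_mult')
  then have "(\<integral>\<^sup>+u. ennreal ((cmod (fourier G (- u)))\<^sup>2) \<partial>lborel) < \<infinity>"
    by (rule le_less_trans) simp
  then have iG': "integrable lborel (\<lambda>u. (cmod (fourier G (- u)))\<^sup>2)"
    by (intro integrableI_bounded) auto
  then have iG: "integrable lborel (\<lambda>u. (cmod (?G u))\<^sup>2)"
    by (simp add: norm_mult norm_divide power_divide)
  have "(\<integral>u. (cmod (fourier G (- u)))\<^sup>2 \<partial>lborel) \<le> 2 * pi * (\<integral>t. (cmod (G t))\<^sup>2 \<partial>lborel)"
    using G_refl by (simp add: nn_integral_eq_integral[OF iG'])
  then have G_le: "(\<integral>u. (cmod (?G u))\<^sup>2 \<partial>lborel) \<le> 1 / (2 * pi) * (\<integral>t. (cmod (G t))\<^sup>2 \<partial>lborel)"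
    by (simp add: norm_mult norm_divide power_divide field_simps power2_eq_square)
  have iC: "integrable lborel (\<lambda>u. ?F u * cnj (?G u))"
    by (rule integrable_mult_bounded[OF F, where B="1 / (2 * pi) * (\<integral>t. cmod (G t) \<partial>lborel)"])
       (auto simp: norm_divide intro!: divide_right_mono cmod_fourier_le)
  have iD: "integrable lborel (\<lambda>t. cnj (G t) * ?H t)"
    by (rule integrable_mult_bounded[where B="\<integral>t. cmod (?F t) \<partial>lborel"])
       (use G in \<open>auto intro!: cmod_fourier_le simp del: norm_of_real\<close>)
  have cross: "(\<integral>u. Re (?F u * cnj (?G u)) \<partial>lborel) = 1 / (2 * pi) * (\<integral>t. Re (?H t * cnj (G t)) \<partial>lborel)"
  proof -
    have Re_scale: "Re (of_real a * z) = a * Re z" for a z by simp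
    have "(\<integral>u. ?F u * cnj (?G u) \<partial>lborel) = of_real (1 / (2 * pi)) * (\<integral>u. ?F u * cnj (fourier G (- u)) \<partial>lborel)"
      by (subst integral_mult_right_zero[symmetric]) (simp add: mult_ac)
    then have "(\<integral>u. ?F u * cnj (?G u) \<partial>lborel) = of_real (1 / (2 * pi)) * (\<integral>t. ?H t * cnj (G t) \<partial>lborel)"
      by (simp only: fourier_parseval[OF F G])
    then have "Re (\<integral>u. ?F u * cnj (?G u) \<partial>lborel) = 1 / (2 * pi) * Re (\<integral>t. ?H t * cnj (G t) \<partial>lborel)"
      by (simp only: Re_scale)
    moreover have "integrable lborel (\<lambda>t. ?H t * cnj (G t))" using iD by (simp add: mult.commute)
    ultimately show ?thesis
      using iC by (simp only: integral_Re)
  qed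
  have iD': "integrable lborel (\<lambda>t. ?H t * cnj (G t))" using iD by (simp add: mult.commute)
  have "(\<integral>\<^sup>+u. ennreal ((cmod (?F u - ?G u))\<^sup>2) \<partial>lborel) =
      ennreal ((\<integral>u. (h u)\<^sup>2 \<partial>lborel) - 2 * (\<integral>u. Re (?F u * cnj (?G u)) \<partial>lborel) + (\<integral>u. (cmod (?G u))\<^sup>2 \<partial>lborel))"
  proof -
    have sq: "(cmod (?F u - ?G u))\<^sup>2 = (h u)\<^sup>2 - 2 * Re (?F u * cnj (?G u)) + (cmod (?G u))\<^sup>2" for u
      unfolding cmod_diff_power2 by simp
    have iR: "integrable lborel (\<lambda>u. Re (?F u * cnj (?G u)))" using iC by (rule integrable_Re)
    have "integrable lborel (\<lambda>u. (cmod (?F u - ?G u))\<^sup>2)"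
      unfolding sq by (intro Bochner_Integration.integrable_add Bochner_Integration.integrable_diff ih iG integrable_mult_right iR)
    then have "(\<integral>\<^sup>+u. ennreal ((cmod (?F u - ?G u))\<^sup>2) \<partial>lborel) = ennreal (\<integral>u. (cmod (?F u - ?G u))\<^sup>2 \<partial>lborel)"
      by (rule nn_integral_eq_integral) simp
    then show ?thesis
      unfolding sq using ih iG iR
      by (simp only: Bochner_Integration.integral_add Bochner_Integration.integral_diff Bochner_Integration.integrable_add Bochner_Integration.integrable_diff integrable_mult_right integral_mult_right_zero)
  qed
  also have "\<dots> \<le> ennreal (1 / (2 * pi) * ((\<integral>t. (cmod (?H t))\<^sup>2 \<partial>lborel) - 2 * (\<integral>t. Re (?H t * cnj (G t)) \<partial>lborel)
      + (\<integral>t. (cmod (G t))\<^sup>2 \<partial>lborel)))"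
    using h_le' G_le unfolding cross by (intro ennreal_leI) (simp add: algebra_simps)
  also have "\<dots> = ennreal (1 / (2 * pi)) * (\<integral>\<^sup>+t. ennreal ((cmod (?H t - G t))\<^sup>2) \<partial>lborel)"
  proof -
    have iR: "integrable lborel (\<lambda>t. Re (?H t * cnj (G t)))" using iD' by (rule integrable_Re)
    have "integrable lborel (\<lambda>t. (cmod (?H t - G t))\<^sup>2)"
      unfolding cmod_diff_power2 by (intro Bochner_Integration.integrable_add Bochner_Integration.integrable_diff iH G2 integrable_mult_right iR)
    then have "(\<integral>\<^sup>+t. ennreal ((cmod (?H t - G t))\<^sup>2) \<partial>lborel) = ennreal (\<integral>t. (cmod (?H t - G t))\<^sup>2 \<partial>lborel)"
      by (rule nn_integral_eq_integral) simp
    also have "(\<integral>t. (cmod (?H t - G t))\<^sup>2 \<partial>lborel) = (\<integral>t. (cmod (?H t))\<^sup>2 \<partial>lborel) - 2 * (\<integral>t. Re (?H t * cnj (G t)) \<partial>lborel)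
      + (\<integral>t. (cmod (G t))\<^sup>2 \<partial>lborel)"
      unfolding cmod_diff_power2 using iH G2 iR
      by (simp only: Bochner_Integration.integral_add Bochner_Integration.integral_diff Bochner_Integration.integrable_add Bochner_Integration.integrable_diff integrable_mult_right integral_mult_right_zero)
    finally show ?thesis
      by (simp only:) (rule ennreal_mult', simp)
  qed
  finally show ?thesis .
qed

section \<open>The Mellin transform as an expectation\<close>

text \<open>
  The character \<open>x \<mapsto> x powr (c - 1 + \<i> * t)\<close> in polar form, which is jointly measurable in \<open>t\<close> and \<open>x\<close> and agrees
with the complex power for \<open>x > 0\<close>.
\<close>

definition mellin_char :: "real \<Rightarrow> real \<Rightarrow> real \<Rightarrow> complex" where
  "mellin_char c t x = of_real (x powr (c - 1)) * cis (t * ln x)"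

lemma borel_measurable_mellin_char [measurable (raw)]:
  assumes [measurable]: "p \<in> borel_measurable M" "q \<in> borel_measurable M"
  shows "(\<lambda>w. mellin_char c (p w) (q w)) \<in> borel_measurable M"
  unfolding mellin_char_def by measurable

lemma complex_powr_pos:
  assumes "x > 0"
  shows "complex_of_real x powr Complex a t = of_real (x powr a) * cis (t * ln x)"
proof -
  have "complex_of_real x powr Complex a t = exp (Complex a t * of_real (ln x))"
    using assms by (simp add: powr_def Ln_of_real)
  also have "Complex a t * of_real (ln x) = of_real (a * ln x) + \<i> * of_real (t * ln x)"
    by (simp add: complex_eq_iff)
  finally show ?thesis
    using assms by (simp only: exp_add cis_conv_exp exp_of_real) (simp add: powr_def)
qed

lemma complex_powr_eq_mellin_char:
  "x > 0 \<Longrightarrow> complex_of_real x powr Complex (c - 1) t = mellin_char c t x"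
  unfolding mellin_char_def by (rule complex_powr_pos)

lemma cmod_mellin_char: "cmod (mellin_char c t x) = x powr (c - 1)"
  by (simp add: mellin_char_def norm_mult)

lemma mellin_char_mult:
  "x > 0 \<Longrightarrow> u > 0 \<Longrightarrow> mellin_char c t (x * u) = mellin_char c t x * mellin_char c t u"
  by (simp add: mellin_char_def powr_mult ln_mult distrib_left mult_ac flip: cis_mult)

lemma mellin_char_uminus: "mellin_char c (- t) x = cnj (mellin_char c t x)"
  by (simp add: mellin_char_def cis_cnj)

lemma powr_twice: "x powr (2 * (c - 1)) = (x powr (c - 1))\<^sup>2" for x c :: real
  by (simp only: power2_eq_square mult_2 powr_add)

text \<open>
  The density cut off to the half-line: nonnegative and measurable on the whole line, unlike the function it
comes from.
\<close>

definition pos_part :: "(real \<Rightarrow> real) \<Rightarrow> real \<Rightarrow> real" where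
  "pos_part f x = indicator {0<..} x * f x"

lemma pos_density_pos_part:
  assumes "pos_density f"
  shows "pos_part f \<in> borel_measurable borel" and "\<And>x. 0 \<le> pos_part f x"
    and "pos_law (\<lambda>x. ennreal (f x)) = density lborel (\<lambda>x. ennreal (pos_part f x))"
  using assms unfolding pos_density_def pos_law_def
  by (auto simp: pos_part_def[abs_def] set_borel_measurable_def indicator_def intro!: arg_cong[where f="density lborel"] split: if_splits)

lemma prob_space_pos_law:
  assumes "pos_density f"
  shows "prob_space (pos_law (\<lambda>x. ennreal (f x)))"
proof (rule prob_spaceI)
  note f = pos_density_pos_part[OF assms]
  have [measurable]: "pos_part f \<in> borel_measurable borel" by (rule f(1))
  have "(\<integral>\<^sup>+x. ennreal (pos_part f x) \<partial>lborel) = (\<integral>\<^sup>+x\<in>{0<..}. ennreal (f x) \<partial>lborel)"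
    by (intro nn_integral_cong) (auto simp: pos_part_def indicator_def)
  then show "emeasure (pos_law (\<lambda>x. ennreal (f x))) (space (pos_law (\<lambda>x. ennreal (f x)))) = 1"
    using assms by (simp add: f(3) emeasure_density pos_density_def)
qed

lemma sets_pos_law [measurable_cong]: "sets (pos_law p) = sets borel"
  by (simp add: pos_law_def)

lemma space_pos_law [simp]: "space (pos_law p) = UNIV"
  by (simp add: pos_law_def)

lemma AE_pos_law_pos:
  assumes "(\<lambda>x. p x * indicator {0<..} x) \<in> borel_measurable borel"
  shows "AE x in pos_law p. 0 < x"
  unfolding pos_law_def using assms by (subst AE_density) (auto simp: indicator_def)

lemma AE_pos_law_density:
  assumes "pos_density f"
  shows "AE x in pos_law (\<lambda>x. ennreal (f x)). 0 < x"
proof -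
  have [measurable]: "pos_part f \<in> borel_measurable borel" by (rule pos_density_pos_part(1)[OF assms])
  show ?thesis
    unfolding pos_density_pos_part(3)[OF assms] by (subst AE_density) (measurable, auto simp: pos_part_def indicator_def)
qed

lemma mellin_eq_expectation:
  assumes "pos_density f"
  shows "mellin_real c f t = (\<integral>x. mellin_char c t x \<partial>pos_law (\<lambda>x. ennreal (f x)))"
proof -
  note f = pos_density_pos_part[OF assms]
  have [measurable]: "pos_part f \<in> borel_measurable borel" by (rule f(1))
  have "(\<integral>x. mellin_char c t x \<partial>pos_law (\<lambda>x. ennreal (f x))) = (\<integral>x. pos_part f x *\<^sub>R mellin_char c t x \<partial>lborel)"
    unfolding f(3) by (rule integral_density) (auto simp: f(2))
  also have "\<dots> = mellin_real c f t"
    unfolding mellin_def set_lebesgue_integral_def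
    by (intro Bochner_Integration.integral_cong)
       (auto simp: pos_part_def indicator_def complex_powr_eq_mellin_char scaleR_conv_of_real)
  finally show ?thesis ..
qed

text \<open>
  The law is a probability, so a finite second moment of \<open>x powr (c - 1)\<close> bounds the first.
\<close>

lemma integrable_powr_pos_law:
  assumes f: "pos_density f" and m: "pos_moment f (2 * (c - 1)) < \<infinity>"
  shows "integrable (pos_law (\<lambda>x. ennreal (f x))) (\<lambda>x. (x powr (c - 1))\<^sup>2)"
    and "integrable (pos_law (\<lambda>x. ennreal (f x))) (\<lambda>x. x powr (c - 1))"
    and "integrable (pos_law (\<lambda>x. ennreal (f x))) (mellin_char c t)"
proof -
  interpret prob_space "pos_law (\<lambda>x. ennreal (f x))" by (rule prob_space_pos_law[OF f])
  show 2: "integrable (pos_law (\<lambda>x. ennreal (f x))) (\<lambda>x. (x powr (c - 1))\<^sup>2)"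
    using m unfolding pos_moment_def powr_twice by (intro integrableI_bounded) auto
  show 1: "integrable (pos_law (\<lambda>x. ennreal (f x))) (\<lambda>x. x powr (c - 1))"
    by (rule square_integrable_imp_integrable[OF _ 2]) measurable
  show "integrable (pos_law (\<lambda>x. ennreal (f x))) (mellin_char c t)"
    by (rule Bochner_Integration.integrable_bound[OF 1]) (auto simp: cmod_mellin_char)
qed

lemma borel_measurable_mellin:
  assumes "pos_density f"
  shows "mellin_real c f \<in> borel_measurable borel"
proof -
  interpret prob_space "pos_law (\<lambda>x. ennreal (f x))" by (rule prob_space_pos_law[OF assms])
  have "(\<lambda>t. \<integral>x. mellin_char c t x \<partial>pos_law (\<lambda>x. ennreal (f x))) \<in> borel_measurable borel"
    by measurable
  then show ?thesis
    by (simp add: mellin_eq_expectation[OF assms, abs_def])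
qed

lemma mellin_uminus:
  assumes "pos_density f"
  shows "mellin_real c f (- t) = cnj (mellin_real c f t)"
  unfolding mellin_eq_expectation[OF assms] mellin_char_uminus by simp

section \<open>Products of independent positive variables\<close>

text \<open>
  Tonelli's theorem and the substitution \<open>y = x * u\<close>, whose Jacobian \<open>x\<close> cancels the factor \<open>1 / x\<close> in the
multiplicative convolution.
\<close>

lemma pos_law_mult_conv:
  assumes f: "pos_density f" and g: "pos_density g"
  shows "pos_law (mult_conv f g) =
    distr (pos_law (\<lambda>x. ennreal (f x)) \<Otimes>\<^sub>M pos_law (\<lambda>x. ennreal (g x))) borel (\<lambda>(x, u). x * u)"
    and "(\<lambda>y. mult_conv f g y * indicator {0<..} y) \<in> borel_measurable borel"
proof -
  note f0 = pos_density_pos_part[OF f] and g0 = pos_density_pos_part[OF g]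
  let ?f = "pos_part f" and ?g = "pos_part g"
  let ?P = "pos_law (\<lambda>x. ennreal (f x))" and ?Q = "pos_law (\<lambda>x. ennreal (g x))"
  have [measurable]: "?f \<in> borel_measurable borel" "?g \<in> borel_measurable borel" by (rule f0(1) g0(1))+
  interpret P: prob_space ?P by (rule prob_space_pos_law[OF f])
  interpret Q: prob_space ?Q by (rule prob_space_pos_law[OF g])
  interpret PQ: pair_sigma_finite ?P ?Q ..
  define q where "q = (\<lambda>y. \<integral>\<^sup>+x. ennreal (?f x * ?g (y / x) / x) \<partial>lborel)"
  have [measurable]: "q \<in> borel_measurable borel" unfolding q_def by measurable
  have q: "(\<lambda>y. mult_conv f g y * indicator {0<..} y) = q"
  proof
    fix y
    have "(\<integral>\<^sup>+x\<in>{0<..}. ennreal (f x * g (y / x) / x) \<partial>lborel) * indicator {0<..} y =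
        (\<integral>\<^sup>+x. ennreal (?f x * ?g (y / x) / x) \<partial>lborel)"
    proof (cases "y > 0")
      case True
      then show ?thesis
        by simp (intro nn_integral_cong, auto simp: pos_part_def indicator_def)
    next
      case False
      then have "?f x * ?g (y / x) / x = 0" for x
        by (auto simp: pos_part_def indicator_def zero_less_divide_iff)
      then show ?thesis using False by (simp only: ennreal_0 nn_integral_const) simp
    qed
    then show "mult_conv f g y * indicator {0<..} y = q y"
      by (simp add: mult_conv_def q_def)
  qed
  show "(\<lambda>y. mult_conv f g y * indicator {0<..} y) \<in> borel_measurable borel"
    unfolding q by measurable
  show "pos_law (mult_conv f g) = distr (?P \<Otimes>\<^sub>M ?Q) borel (\<lambda>(x, u). x * u)"
  proof (rule measure_eqI)
    show "sets (pos_law (mult_conv f g)) = sets (distr (?P \<Otimes>\<^sub>M ?Q) borel (\<lambda>(x, u). x * u))"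
      by (simp add: sets_pos_law)
    fix A assume "A \<in> sets (pos_law (mult_conv f g))"
    then have [measurable]: "A \<in> sets borel" by (simp add: sets_pos_law)
    have inner: "(\<integral>\<^sup>+y. ennreal (?f x * ?g (y / x) / x) * indicator A y \<partial>lborel) =
        ennreal (?f x) * (\<integral>\<^sup>+u. ennreal (?g u) * indicator A (x * u) \<partial>lborel)" for x
    proof (cases "x > 0")
      case True
      have "(\<integral>\<^sup>+y. ennreal (?f x * ?g (y / x) / x) * indicator A y \<partial>lborel) =
          ennreal x * (\<integral>\<^sup>+u. ennreal (?f x * ?g u / x) * indicator A (x * u) \<partial>lborel)"
        using True by (subst nn_integral_real_affine[where c=x and t=0]) auto
      also have "\<dots> = (\<integral>\<^sup>+u. ennreal (?f x) * (ennreal (?g u) * indicator A (x * u)) \<partial>lborel)"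
        using True by (subst nn_integral_cmult[symmetric])
          (auto intro!: nn_integral_cong simp: f0(2) g0(2) indicator_def simp flip: ennreal_mult)
      finally show ?thesis by (simp add: nn_integral_cmult)
    qed (simp add: pos_part_def)
    have "emeasure (pos_law (mult_conv f g)) A = (\<integral>\<^sup>+y. q y * indicator A y \<partial>lborel)"
      unfolding pos_law_def q by (rule emeasure_density) auto
    also have "\<dots> = (\<integral>\<^sup>+y. (\<integral>\<^sup>+x. ennreal (?f x * ?g (y / x) / x) * indicator A y \<partial>lborel) \<partial>lborel)"
      unfolding q_def by (simp add: nn_integral_multc)
    also have "\<dots> = (\<integral>\<^sup>+x. (\<integral>\<^sup>+y. ennreal (?f x * ?g (y / x) / x) * indicator A y \<partial>lborel) \<partial>lborel)"
      by (rule lborel_pair.Fubini') measurable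
    also have "\<dots> = (\<integral>\<^sup>+x. ennreal (?f x) * (\<integral>\<^sup>+u. ennreal (?g u) * indicator A (x * u) \<partial>lborel) \<partial>lborel)"
      unfolding inner ..
    also have "\<dots> = (\<integral>\<^sup>+x. (\<integral>\<^sup>+u. indicator A (x * u) \<partial>?Q) \<partial>?P)"
      by (simp add: f0(3) g0(3) nn_integral_density)
    also have "\<dots> = (\<integral>\<^sup>+z. indicator A (fst z * snd z) \<partial>(?P \<Otimes>\<^sub>M ?Q))"
      by (subst Q.nn_integral_fst[symmetric]) auto
    also have "\<dots> = emeasure (distr (?P \<Otimes>\<^sub>M ?Q) borel (\<lambda>(x, u). x * u)) A"
      by (subst nn_integral_indicator[symmetric], simp, subst nn_integral_distr) (auto simp: case_prod_beta)
    finally show "emeasure (pos_law (mult_conv f g)) A = emeasure (distr (?P \<Otimes>\<^sub>M ?Q) borel (\<lambda>(x, u). x * u)) A" .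
  qed
qed

lemma product_law_moments:
  assumes f: "pos_density f" and g: "pos_density g"
    and mf: "pos_moment f (2 * (c - 1)) < \<infinity>" and mg: "pos_moment g (2 * (c - 1)) < \<infinity>"
  defines "M \<equiv> pos_law (mult_conv f g)"
  shows "prob_space M" and "AE y in M. 0 < y"
    and "integrable M (mellin_char c t)"
    and "integrable M (\<lambda>y. (cmod (mellin_char c t y))\<^sup>2)"
    and "(\<integral>y. mellin_char c t y \<partial>M) = mellin_real c f t * mellin_real c g t"
    and "(\<integral>y. (cmod (mellin_char c t y))\<^sup>2 \<partial>M) = enn2real (pos_moment f (2 * (c - 1))) * enn2real (pos_moment g (2 * (c - 1)))"
proof -
  let ?P = "pos_law (\<lambda>x. ennreal (f x))" and ?Q = "pos_law (\<lambda>x. ennreal (g x))"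
  interpret P: prob_space ?P by (rule prob_space_pos_law[OF f])
  interpret Q: prob_space ?Q by (rule prob_space_pos_law[OF g])
  interpret PQ: pair_prob_space ?P ?Q ..
  have M: "M = distr (?P \<Otimes>\<^sub>M ?Q) borel (\<lambda>(x, u). x * u)"
    unfolding M_def by (rule pos_law_mult_conv(1)[OF f g])
  show "prob_space M"
    unfolding M by (rule PQ.prob_space_distr) measurable
  show "AE y in M. 0 < y"
    unfolding M_def by (rule AE_pos_law_pos[OF pos_law_mult_conv(2)[OF f g]])
  \<comment> \<open>Both integrands are multiplicative on the half-line, hence split over the product measure.\<close>
  have split: "integrable M \<phi> \<and> (\<integral>y. \<phi> y \<partial>M) = (\<integral>x. \<phi> x \<partial>?P) * (\<integral>u. \<phi> u \<partial>?Q)"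
    if [measurable]: "\<phi> \<in> borel_measurable borel" and mult: "\<And>x u. x > 0 \<Longrightarrow> u > 0 \<Longrightarrow> \<phi> (x * u) = \<phi> x * \<phi> u"
      and iP: "integrable ?P \<phi>" and iQ: "integrable ?Q \<phi>" for \<phi> :: "real \<Rightarrow> complex"
  proof -
    have iPQ: "integrable (?P \<Otimes>\<^sub>M ?Q) (\<lambda>(x, u). \<phi> x * \<phi> u)"
    proof (rule PQ.Fubini_integrable)
      show "(\<lambda>(x, u). \<phi> x * \<phi> u) \<in> borel_measurable (?P \<Otimes>\<^sub>M ?Q)" by measurable
      have "integrable ?P (\<lambda>x. norm (\<phi> x) * (\<integral>u. norm (\<phi> u) \<partial>?Q))"
        using iP by auto
      then show "integrable ?P (\<lambda>x. \<integral>u. norm (case (x, u) of (x, u) \<Rightarrow> \<phi> x * \<phi> u) \<partial>?Q)"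
        by (simp add: norm_mult)
      show "AE x in ?P. integrable ?Q (\<lambda>u. case (x, u) of (x, u) \<Rightarrow> \<phi> x * \<phi> u)"
        using iQ by auto
    qed
    have pos: "AE z in ?P \<Otimes>\<^sub>M ?Q. 0 < fst z \<and> 0 < snd z"
    proof (rule PQ.AE_pair_measure)
      show "{z \<in> space (?P \<Otimes>\<^sub>M ?Q). 0 < fst z \<and> 0 < snd z} \<in> sets (?P \<Otimes>\<^sub>M ?Q)" by measurable
      show "AE x in ?P. AE u in ?Q. 0 < fst (x, u) \<and> 0 < snd (x, u)"
        using AE_pos_law_density[OF f] AE_pos_law_density[OF g] by auto
    qed
    have ae: "AE z in ?P \<Otimes>\<^sub>M ?Q. (case z of (x, u) \<Rightarrow> \<phi> x * \<phi> u) = \<phi> (case z of (x, u) \<Rightarrow> x * u)"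
      using pos by eventually_elim (auto simp: mult split: prod.splits)
    have "integrable M \<phi> \<longleftrightarrow> integrable (?P \<Otimes>\<^sub>M ?Q) (\<lambda>z. \<phi> (case z of (x, u) \<Rightarrow> x * u))"
      unfolding M by (rule integrable_distr_eq) measurable
    also have "\<dots> \<longleftrightarrow> integrable (?P \<Otimes>\<^sub>M ?Q) (\<lambda>(x, u). \<phi> x * \<phi> u)"
      by (rule integrable_cong_AE, measurable) (use ae in auto)
    finally have 1: "integrable M \<phi>" using iPQ by simp
    have "(\<integral>y. \<phi> y \<partial>M) = (\<integral>z. \<phi> (case z of (x, u) \<Rightarrow> x * u) \<partial>(?P \<Otimes>\<^sub>M ?Q))"
      unfolding M by (rule integral_distr) measurable
    also have "\<dots> = (\<integral>z. (case z of (x, u) \<Rightarrow> \<phi> x * \<phi> u) \<partial>(?P \<Otimes>\<^sub>M ?Q))"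
      by (rule integral_cong_AE, measurable) (use ae in auto)
    also have "\<dots> = (\<integral>x. (\<integral>u. \<phi> x * \<phi> u \<partial>?Q) \<partial>?P)"
      by (subst PQ.integral_fst'[OF iPQ, symmetric]) simp
    finally show ?thesis using 1 by simp
  qed
  note iP = integrable_powr_pos_law[OF f mf] and iQ = integrable_powr_pos_law[OF g mg]
  have "integrable M (mellin_char c t) \<and> (\<integral>y. mellin_char c t y \<partial>M) =
      (\<integral>x. mellin_char c t x \<partial>?P) * (\<integral>u. mellin_char c t u \<partial>?Q)"
    by (rule split) (auto simp: mellin_char_mult iP(3) iQ(3))
  then show "integrable M (mellin_char c t)"
    "(\<integral>y. mellin_char c t y \<partial>M) = mellin_real c f t * mellin_real c g t"
    by (simp_all add: mellin_eq_expectation f g)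
  have "integrable M (\<lambda>y. complex_of_real ((y powr (c - 1))\<^sup>2)) \<and> (\<integral>y. complex_of_real ((y powr (c - 1))\<^sup>2) \<partial>M) =
      (\<integral>x. complex_of_real ((x powr (c - 1))\<^sup>2) \<partial>?P) * (\<integral>u. complex_of_real ((u powr (c - 1))\<^sup>2) \<partial>?Q)"
  proof (rule split)
    show "integrable ?P (\<lambda>y. complex_of_real ((y powr (c - 1))\<^sup>2))" by (rule integrable_of_real[OF iP(1)])
    show "integrable ?Q (\<lambda>y. complex_of_real ((y powr (c - 1))\<^sup>2))" by (rule integrable_of_real[OF iQ(1)])
  qed (auto simp: powr_mult power_mult_distrib)
  then have i2: "integrable M (\<lambda>y. (y powr (c - 1))\<^sup>2)"
    and e2: "(\<integral>y. (y powr (c - 1))\<^sup>2 \<partial>M) = (\<integral>x. (x powr (c - 1))\<^sup>2 \<partial>?P) * (\<integral>u. (u powr (c - 1))\<^sup>2 \<partial>?Q)"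
    by (simp_all only: complex_of_real_integrable_eq integral_complex_of_real of_real_eq_iff of_real_mult[symmetric])
  show "integrable M (\<lambda>y. (cmod (mellin_char c t y))\<^sup>2)"
    using i2 by (simp add: cmod_mellin_char)
  have "enn2real (pos_moment f (2 * (c - 1))) = (\<integral>x. (x powr (c - 1))\<^sup>2 \<partial>?P)" 
    unfolding pos_moment_def powr_twice by (subst nn_integral_eq_integral[OF iP(1)]) auto
  moreover have "enn2real (pos_moment g (2 * (c - 1))) = (\<integral>x. (x powr (c - 1))\<^sup>2 \<partial>?Q)" 
    unfolding pos_moment_def powr_twice by (subst nn_integral_eq_integral[OF iQ(1)]) auto
  ultimately show "(\<integral>y. (cmod (mellin_char c t y))\<^sup>2 \<partial>M) =
      enn2real (pos_moment f (2 * (c - 1))) * enn2real (pos_moment g (2 * (c - 1)))"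
    using e2 by (simp add: cmod_mellin_char)
qed

section \<open>Mean squared error of a sample mean\<close>

text \<open>
  Expanding the square gives \<open>V (Y i) * cnj (V (Y j))\<close> for all pairs: off the diagonal independence turns its
expectation into the squared modulus of the mean, on the diagonal it is the second moment.
\<close>

lemma (in prob_space) iid_sum_second_moment:
  fixes V :: "'a \<Rightarrow> complex" and I :: "'i set"
  assumes V: "integrable M V" and V2: "integrable M (\<lambda>x. (cmod (V x))\<^sup>2)" and I: "finite I"
  shows "integrable (PiM I (\<lambda>_. M)) (\<lambda>Y. (cmod (\<Sum>j\<in>I. V (Y j)))\<^sup>2)"
    and "(\<integral>Y. (cmod (\<Sum>j\<in>I. V (Y j)))\<^sup>2 \<partial>PiM I (\<lambda>_. M)) =
      (real (card I))\<^sup>2 * (cmod (expectation V))\<^sup>2 +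
      real (card I) * (expectation (\<lambda>x. (cmod (V x))\<^sup>2) - (cmod (expectation V))\<^sup>2)"
proof -
  interpret P: product_sigma_finite "\<lambda>_::'i. M" ..
  have [measurable]: "V \<in> borel_measurable M" using V by auto
  let ?N = "PiM I (\<lambda>_. M)"
  \<comment> \<open>Factors of \<open>V (Y i) * cnj (V (Y j))\<close> by coordinate, arranged so that \<open>i = j\<close> needs no separate definition.\<close>
  define w :: "'i \<Rightarrow> 'i \<Rightarrow> 'i \<Rightarrow> 'a \<Rightarrow> complex" where "w = (\<lambda>i j k x. (if k = i then V x else 1) * (if k = j then cnj (V x) else 1))"
  let ?S = "expectation (\<lambda>x. (cmod (V x))\<^sup>2)" and ?m = "(cmod (expectation V))\<^sup>2"
  have sq: "V x * cnj (V x) = of_real ((cmod (V x))\<^sup>2)" for x by (simp only: complex_norm_square)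
  have iw: "integrable M (w i j k)" for i j k
    using V V2 by (cases "k = i"; cases "k = j") (simp_all add: w_def[abs_def] sq del: of_real_power)
  have prod_w: "(\<Prod>k\<in>I. w i j k (Y k)) = V (Y i) * cnj (V (Y j))" if "i \<in> I" "j \<in> I" for i j Y
    unfolding w_def prod.distrib using I that by (simp add: prod.delta')
  have int: "integrable ?N (\<lambda>Y. V (Y i) * cnj (V (Y j)))" if "i \<in> I" "j \<in> I" for i j
    using P.product_integrable_prod[where f="w i j", OF I iw] prod_w[OF that] by simp
  have E: "(\<integral>Y. V (Y i) * cnj (V (Y j)) \<partial>?N) = of_real (?m + (if i = j then ?S - ?m else 0))"
    if "i \<in> I" "j \<in> I" for i j
  proof -
    have "(\<integral>Y. V (Y i) * cnj (V (Y j)) \<partial>?N) = (\<Prod>k\<in>I. expectation (w i j k))"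
      using P.product_integral_prod[where f="w i j", OF I iw] prod_w[OF that] by simp
    also have "\<dots> = of_real (?m + (if i = j then ?S - ?m else 0))"
    proof (cases "i = j")
      case True
      have "expectation (w i j k) = (if k = i then of_real ?S else 1)" for k
        using True by (simp add: w_def[abs_def] sq prob_space del: of_real_power)
      then show ?thesis using True I that by simp
    next
      case False
      then have "expectation (w i j k) = (if k = i then expectation V else 1) * (if k = j then cnj (expectation V) else 1)" for k
        by (simp add: w_def[abs_def] prob_space)
      then have "(\<Prod>k\<in>I. expectation (w i j k)) = expectation V * cnj (expectation V)"
        using I that by (simp add: prod.distrib)
      then show ?thesis using False by (simp only: complex_norm_square if_False add_0_right)
    qed
    finally show ?thesis .
  qed
  have expand: "complex_of_real ((cmod (\<Sum>j\<in>I. V (Y j)))\<^sup>2) = (\<Sum>i\<in>I. \<Sum>j\<in>I. V (Y i) * cnj (V (Y j)))" for Y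
    by (simp only: complex_norm_square cnj_sum sum_product)
  have iC: "integrable ?N (\<lambda>Y. complex_of_real ((cmod (\<Sum>j\<in>I. V (Y j)))\<^sup>2))"
    unfolding expand by (intro Bochner_Integration.integrable_sum int)
  then show "integrable ?N (\<lambda>Y. (cmod (\<Sum>j\<in>I. V (Y j)))\<^sup>2)"
    by (simp only: complex_of_real_integrable_eq)
  have "complex_of_real (\<integral>Y. (cmod (\<Sum>j\<in>I. V (Y j)))\<^sup>2 \<partial>?N) = (\<Sum>i\<in>I. \<Sum>j\<in>I. (\<integral>Y. V (Y i) * cnj (V (Y j)) \<partial>?N))"
    unfolding integral_complex_of_real[symmetric] expand
    by (simp add: Bochner_Integration.integral_sum Bochner_Integration.integrable_sum int)
  also have "\<dots> = (\<Sum>i\<in>I. \<Sum>j\<in>I. of_real (?m + (if i = j then ?S - ?m else 0)))"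
    by (intro sum.cong refl E)
  also have "\<dots> = of_real (\<Sum>i\<in>I. \<Sum>j\<in>I. ?m + (if i = j then ?S - ?m else 0))"
    by (simp only: of_real_sum)
  also have "(\<Sum>i\<in>I. \<Sum>j\<in>I. ?m + (if i = j then ?S - ?m else 0)) =
      (real (card I))\<^sup>2 * ?m + real (card I) * (?S - ?m)"
    using I by (simp add: sum.distrib power2_eq_square distrib_left)
  finally show "(\<integral>Y. (cmod (\<Sum>j\<in>I. V (Y j)))\<^sup>2 \<partial>?N) = (real (card I))\<^sup>2 * ?m + real (card I) * (?S - ?m)"
    by (simp only: of_real_eq_iff)
qed

text \<open>
  With \<open>V = a - Z * b\<close>, the error is the sample mean of the \<open>V (Y j)\<close>, so its second moment is the squared
mean of \<open>V\<close> plus the variance of \<open>V\<close> over \<open>n\<close>; that variance is \<open>\<bar>b\<bar>\<^sup>2\<close> times the one of \<open>Z\<close>.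
\<close>

lemma (in prob_space) sample_mean_risk:
  fixes Z :: "'a \<Rightarrow> complex"
  assumes Z: "integrable M Z" and Z2: "integrable M (\<lambda>x. (cmod (Z x))\<^sup>2)" and n: "n \<ge> 1"
  shows "(\<integral>\<^sup>+Y. ennreal ((cmod (a - (\<Sum>j = 1..n. Z (Y j)) / of_nat n * b))\<^sup>2) \<partial>PiM {1..n} (\<lambda>_. M)) \<le>
    ennreal ((cmod (a - expectation Z * b))\<^sup>2 + (cmod b)\<^sup>2 * expectation (\<lambda>x. (cmod (Z x))\<^sup>2) / real n)"
proof -
  have [measurable]: "Z \<in> borel_measurable M" using Z by auto
  define V where "V = (\<lambda>x. a - Z x * b)"
  have V: "integrable M V" unfolding V_def using Z by auto
  have EV: "expectation V = a - expectation Z * b"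
    unfolding V_def using Z by (simp add: prob_space)
  define D where "D = (\<lambda>x. Re (a * cnj (Z x * b)))"
  have iD: "integrable M D"
    unfolding D_def using Z by (intro integrable_Re integrable_mult_right integrable_cnj integrable_mult_left)
  have V_sq: "(cmod (V x))\<^sup>2 = (cmod a)\<^sup>2 - 2 * D x + (cmod b)\<^sup>2 * (cmod (Z x))\<^sup>2" for x
    unfolding V_def D_def cmod_diff_power2 by (simp add: norm_mult power_mult_distrib)
  have V2: "integrable M (\<lambda>x. (cmod (V x))\<^sup>2)"
    unfolding V_sq using iD Z2 by simp
  have "expectation (\<lambda>x. (cmod (V x))\<^sup>2) = (cmod a)\<^sup>2 - 2 * expectation D +
      (cmod b)\<^sup>2 * expectation (\<lambda>x. (cmod (Z x))\<^sup>2)"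
    unfolding V_sq using iD Z2 by (simp add: prob_space)
  also have "expectation D = Re (a * cnj (expectation Z * b))"
    unfolding D_def using Z by (subst integral_Re) auto
  finally have var: "expectation (\<lambda>x. (cmod (V x))\<^sup>2) - (cmod (expectation V))\<^sup>2 \<le> (cmod b)\<^sup>2 * expectation (\<lambda>x. (cmod (Z x))\<^sup>2)"
    unfolding EV cmod_diff_power2 by simp
  have mean: "(cmod (a - (\<Sum>j = 1..n. Z (Y j)) / of_nat n * b))\<^sup>2 = (cmod (\<Sum>j = 1..n. V (Y j)))\<^sup>2 / (real n)\<^sup>2" for Y
  proof -
    have "(\<Sum>j = 1..n. V (Y j)) = of_nat n * (a - (\<Sum>j = 1..n. Z (Y j)) / of_nat n * b)"
      using n by (simp add: V_def sum_subtractf sum_distrib_right right_diff_distrib)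
    then show ?thesis using n by (simp add: norm_mult power_mult_distrib)
  qed
  note iid = iid_sum_second_moment[OF V V2 finite_atLeastAtMost, of "1::nat" n]
  have "(\<integral>\<^sup>+Y. ennreal ((cmod (a - (\<Sum>j = 1..n. Z (Y j)) / of_nat n * b))\<^sup>2) \<partial>PiM {1..n} (\<lambda>_. M)) =
      ennreal ((\<integral>Y. (cmod (\<Sum>j = 1..n. V (Y j)))\<^sup>2 \<partial>PiM {1..n} (\<lambda>_. M)) / (real n)\<^sup>2)"
    unfolding mean by (subst nn_integral_eq_integral) (use iid(1) in auto)
  also have "\<dots> = ennreal ((cmod (expectation V))\<^sup>2 + (expectation (\<lambda>x. (cmod (V x))\<^sup>2) - (cmod (expectation V))\<^sup>2) / real n)"
  proof -
    have "((real n)\<^sup>2 * m + real n * v) / (real n)\<^sup>2 = m + v / real n" for m v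
      using n by (simp add: add_divide_distrib power2_eq_square)
    then show ?thesis by (simp only: iid(2) card_atLeastAtMost diff_Suc_1)
  qed
  also have "\<dots> \<le> ennreal ((cmod (expectation V))\<^sup>2 + (cmod b)\<^sup>2 * expectation (\<lambda>x. (cmod (Z x))\<^sup>2) / real n)"
    by (intro ennreal_leI add_left_mono divide_right_mono var) simp
  finally show ?thesis unfolding EV .
qed

section \<open>From the half-line to the real line\<close>

lemma nn_integral_exp_substitution:
  fixes F :: "real \<Rightarrow> ennreal"
  assumes [measurable]: "F \<in> borel_measurable borel"
  shows "(\<integral>\<^sup>+x\<in>{0<..}. F x \<partial>lborel) = (\<integral>\<^sup>+u. F (exp u) * ennreal (exp u) \<partial>lborel)"
proof -
  let ?a = "\<lambda>n::nat. real (Suc n)"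
  have step: "(\<integral>\<^sup>+x. F x * indicator {exp (- ?a n)..exp (?a n)} x \<partial>lborel) =
      (\<integral>\<^sup>+u. F (exp u) * ennreal (exp u) * indicator {- ?a n..?a n} u \<partial>lborel)" for n
    by (rule nn_integral_substitution_aux) (auto intro!: derivative_eq_intros continuous_intros)
  have bound: "eventually (\<lambda>n. x \<le> ?a n) sequentially" for x
    using eventually_ge_at_top[of "nat \<lceil>x\<rceil>"] by eventually_elim linarith
  have "(\<lambda>n. \<integral>\<^sup>+u. F (exp u) * ennreal (exp u) * indicator {- ?a n..?a n} u \<partial>lborel)
      \<longlonglongrightarrow> (\<integral>\<^sup>+u. F (exp u) * ennreal (exp u) \<partial>lborel)"
  proof (rule nn_integral_LIMSEQ)
    show "incseq (\<lambda>n u. F (exp u) * ennreal (exp u) * indicator {- ?a n..?a n} u)"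
      by (auto simp: incseq_def le_fun_def indicator_def)
    show "(\<lambda>n. F (exp u) * ennreal (exp u) * indicator {- ?a n..?a n} u) \<longlonglongrightarrow> F (exp u) * ennreal (exp u)" for u
    proof (rule tendsto_eventually)
      show "eventually (\<lambda>n. F (exp u) * ennreal (exp u) * indicator {- ?a n..?a n} u = F (exp u) * ennreal (exp u)) sequentially"
        using bound[of "\<bar>u\<bar>"] by eventually_elim (auto simp: indicator_def)
    qed
  qed measurable
  moreover have "(\<lambda>n. \<integral>\<^sup>+x. F x * indicator {exp (- ?a n)..exp (?a n)} x \<partial>lborel) \<longlonglongrightarrow> (\<integral>\<^sup>+x\<in>{0<..}. F x \<partial>lborel)"
  proof (rule nn_integral_LIMSEQ)
    show "incseq (\<lambda>n x. F x * indicator {exp (- ?a n)..exp (?a n)} x)"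
    proof (rule incseq_SucI, rule le_funI)
      fix n x
      have mono: "S \<subseteq> T \<Longrightarrow> F x * indicator S x \<le> F x * indicator T x" for S T
        by (auto simp: indicator_def)
      show "F x * indicator {exp (- ?a n)..exp (?a n)} x \<le> F x * indicator {exp (- ?a (Suc n))..exp (?a (Suc n))} x"
        by (rule mono) simp
    qed
    show "(\<lambda>n. F x * indicator {exp (- ?a n)..exp (?a n)} x) \<longlonglongrightarrow> F x * indicator {0<..} x" for x
    proof (rule tendsto_eventually, cases "x > 0")
      case True
      show "eventually (\<lambda>n. F x * indicator {exp (- ?a n)..exp (?a n)} x = F x * indicator {0<..} x) sequentially"
        using bound[of "\<bar>ln x\<bar>"]
      proof eventually_elim
        case (elim n)
        then have "- ?a n \<le> ln x" "ln x \<le> ?a n" by auto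
        then have "exp (- ?a n) \<le> x" "x \<le> exp (?a n)"
          using True by (metis exp_le_cancel_iff exp_ln)+
        then show ?case using True by (simp add: indicator_def)
      qed
    next
      case False
      then have "\<not> exp z \<le> x" for z using exp_gt_zero[of z] by linarith
      then show "eventually (\<lambda>n. F x * indicator {exp (- ?a n)..exp (?a n)} x = F x * indicator {0<..} x) sequentially"
        using False by (simp add: indicator_def)
    qed
  qed measurable
  ultimately show ?thesis
    unfolding step by (rule LIMSEQ_unique[rotated])
qed

lemma pos_law_exp:
  assumes f: "pos_density f"
  shows "pos_law (\<lambda>x. ennreal (f x)) = distr (density lborel (\<lambda>u. ennreal (pos_part f (exp u) * exp u))) borel exp"
proof (rule measure_eqI)
  note f0 = pos_density_pos_part[OF f]
  let ?f = "pos_part f"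
  have [measurable]: "?f \<in> borel_measurable borel" by (rule f0(1))
  show "sets (pos_law (\<lambda>x. ennreal (f x))) = sets (distr (density lborel (\<lambda>u. ennreal (?f (exp u) * exp u))) borel exp)"
    by (simp add: sets_pos_law)
  fix A assume "A \<in> sets (pos_law (\<lambda>x. ennreal (f x)))"
  then have [measurable]: "A \<in> sets borel" by (simp add: sets_pos_law)
  have [measurable]: "exp -` A \<in> sets (borel :: real measure)"
    using measurable_sets[of exp borel borel A] by simp
  have "emeasure (pos_law (\<lambda>x. ennreal (f x))) A = (\<integral>\<^sup>+x\<in>{0<..}. ennreal (?f x) * indicator A x \<partial>lborel)"
  proof -
    have "emeasure (pos_law (\<lambda>x. ennreal (f x))) A = (\<integral>\<^sup>+x. ennreal (?f x) * indicator A x \<partial>lborel)"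
      unfolding f0(3) by (rule emeasure_density) measurable
    then show ?thesis
      by (simp only:) (auto intro!: nn_integral_cong simp: pos_part_def indicator_def)
  qed
  also have "\<dots> = (\<integral>\<^sup>+u. ennreal (?f (exp u)) * indicator A (exp u) * ennreal (exp u) \<partial>lborel)"
    by (rule nn_integral_exp_substitution) measurable
  also have "\<dots> = (\<integral>\<^sup>+u. ennreal (?f (exp u) * exp u) * indicator (exp -` A) u \<partial>lborel)"
    by (intro nn_integral_cong) (auto simp: f0(2) ennreal_mult indicator_def)
  also have "\<dots> = emeasure (distr (density lborel (\<lambda>u. ennreal (?f (exp u) * exp u))) borel exp) A"
    by (subst emeasure_distr, simp, simp, subst emeasure_density) auto
  finally show "emeasure (pos_law (\<lambda>x. ennreal (f x))) A = \<dots>" .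
qed

text \<open>
  The function whose Fourier transform is the Mellin transform of \<open>f\<close>; its \<open>L\<^sup>2\<close> norm is the
norm of \<open>f\<close> with weight \<open>x powr (2 * c - 1)\<close>.
\<close>

definition log_profile :: "real \<Rightarrow> (real \<Rightarrow> real) \<Rightarrow> real \<Rightarrow> real" where
  "log_profile c f u = exp (c * u) * pos_part f (exp u)"

lemma log_profile:
  assumes f: "pos_density f" and m: "pos_moment f (2 * (c - 1)) < \<infinity>"
  shows "integrable lborel (log_profile c f)" and "\<And>u. 0 \<le> log_profile c f u"
    and "fourier (\<lambda>u. of_real (log_profile c f u)) t = mellin_real c f t"
proof -
  note f0 = pos_density_pos_part[OF f]
  let ?f = "pos_part f"
  have [measurable]: "?f \<in> borel_measurable borel" by (rule f0(1))
  let ?D = "density lborel (\<lambda>u. ennreal (?f (exp u) * exp u))"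
  show "0 \<le> log_profile c f u" for u
    by (simp add: log_profile_def f0(2))
  have weight: "(?f (exp u) * exp u) * (exp u powr (c - 1)) = log_profile c f u" for u
    by (simp add: log_profile_def powr_def left_diff_distrib exp_diff)
  have "integrable (distr ?D borel exp) (\<lambda>x. x powr (c - 1))"
    using integrable_powr_pos_law(2)[OF f m] by (simp add: pos_law_exp[OF f])
  then have "integrable ?D (\<lambda>u. exp u powr (c - 1))"
    by (subst (asm) integrable_distr_eq) auto
  then show "integrable lborel (log_profile c f)"
    by (subst (asm) integrable_density) (auto simp: f0(2) weight[abs_def])
  have "mellin_real c f t = (\<integral>u. mellin_char c t (exp u) \<partial>?D)"
    unfolding mellin_eq_expectation[OF f] pos_law_exp[OF f] by (rule integral_distr) auto
  also have "\<dots> = (\<integral>u. (?f (exp u) * exp u) *\<^sub>R mellin_char c t (exp u) \<partial>lborel)"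
    by (rule integral_density) (auto simp: f0(2))
  also have "\<dots> = fourier (\<lambda>u. of_real (log_profile c f u)) t"
    unfolding fourier_def weight[symmetric]
    by (intro Bochner_Integration.integral_cong) (auto simp: mellin_char_def scaleR_conv_of_real mult_ac)
  finally show "fourier (\<lambda>u. of_real (log_profile c f u)) t = mellin_real c f t" ..
qed

text \<open>
  The integral over \<open>t\<close> is the inverse Mellin transform of \<open>G\<close>, which equals \<open>x powr (- c)\<close> times an inverse Fourier
transform at \<open>ln x\<close>. The factor \<open>exp (c * u)\<close> left over by the substitution \<open>x = exp u\<close> cancels this power and
turns \<open>f\<close> into its log profile, so that the inequality becomes \<open>fourier_inversion_distance\<close>.
\<close>

lemma mellin_inversion_distance:
  assumes f: "pos_density f" and m: "pos_moment f (2 * (c - 1)) < \<infinity>"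
    and fhat: "(\<integral>\<^sup>+t. ennreal ((cmod (mellin_real c f t))\<^sup>2) \<partial>lborel) < \<infinity>"
    and G: "integrable lborel G" and G2: "integrable lborel (\<lambda>t. (cmod (G t))\<^sup>2)"
  shows "weighted_norm_sq c (\<lambda>x. of_real (f x) -
      1 / of_real (2 * pi) * (LINT t|lborel. of_real x powr Complex (- c) (- t) * G t)) \<le>
    ennreal (1 / (2 * pi)) * (\<integral>\<^sup>+t. ennreal ((cmod (mellin_real c f t - G t))\<^sup>2) \<partial>lborel)"
proof -
  note f0 = pos_density_pos_part[OF f]
  note h = log_profile[OF f m]
  let ?f = "pos_part f"
  have [measurable]: "?f \<in> borel_measurable borel" by (rule f0(1))
  have [measurable]: "G \<in> borel_measurable borel" using G by auto
  let ?E = "\<lambda>x. of_real (x powr (- c)) * (of_real (1 / (2 * pi)) * fourier G (- ln x))"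
  have inv: "1 / of_real (2 * pi) * (LINT t|lborel. of_real x powr Complex (- c) (- t) * G t) = ?E x" if "x > 0" for x
  proof -
    have "(LINT t|lborel. of_real x powr Complex (- c) (- t) * G t) =
        (LINT t|lborel. of_real (x powr (- c)) * (G t * cis (t * (- ln x))))"
      using that by (intro Bochner_Integration.integral_cong) (auto simp: complex_powr_pos)
    also have "\<dots> = of_real (x powr (- c)) * fourier G (- ln x)"
      unfolding fourier_def by (rule integral_mult_right_zero)
    finally show ?thesis by simp
  qed
  have "weighted_norm_sq c (\<lambda>x. of_real (f x) -
      1 / of_real (2 * pi) * (LINT t|lborel. of_real x powr Complex (- c) (- t) * G t)) =
    (\<integral>\<^sup>+x\<in>{0<..}. ennreal ((cmod (of_real (?f x) - ?E x))\<^sup>2 * x powr (2 * c - 1)) \<partial>lborel)"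
    unfolding weighted_norm_sq_def
  proof (rule nn_integral_cong)
    fix x :: real
    show "ennreal ((cmod (of_real (f x) - 1 / of_real (2 * pi) * (LINT t|lborel. of_real x powr Complex (- c) (- t) * G t)))\<^sup>2
        * x powr (2 * c - 1)) * indicator {0<..} x = 
      ennreal ((cmod (of_real (?f x) - ?E x))\<^sup>2 * x powr (2 * c - 1)) * indicator {0<..} x"
    proof (cases "x > 0")
      case True
      then show ?thesis unfolding inv[OF True] by (simp add: pos_part_def)
    qed simp
  qed
  also have "\<dots> = (\<integral>\<^sup>+u. ennreal ((cmod (of_real (?f (exp u)) - ?E (exp u)))\<^sup>2 * exp u powr (2 * c - 1)) * ennreal (exp u) \<partial>lborel)"
    by (rule nn_integral_exp_substitution) measurable
  also have "\<dots> = (\<integral>\<^sup>+u. ennreal ((cmod (of_real (log_profile c f u) - of_real (1 / (2 * pi)) * fourier G (- u)))\<^sup>2) \<partial>lborel)"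
  proof (rule nn_integral_cong)
    fix u :: real
    have e: "exp u powr (2 * c - 1) * exp u = (exp (c * u))\<^sup>2"
      by (simp add: powr_def power2_eq_square algebra_simps flip: exp_add)
    have d: "of_real (exp (c * u)) * (of_real (?f (exp u)) - ?E (exp u)) =
        of_real (log_profile c f u) - of_real (1 / (2 * pi)) * fourier G (- u)"
    proof -
      have "complex_of_real (exp (c * u)) * of_real (exp u powr (- c)) = 1"
        by (simp add: powr_def flip: of_real_mult exp_add)
      then show ?thesis
        by (simp only: log_profile_def right_diff_distrib of_real_mult mult.assoc[symmetric] ln_exp mult_1_left)
    qed
    have "(cmod (of_real (?f (exp u)) - ?E (exp u)))\<^sup>2 * exp u powr (2 * c - 1) * exp u =
        (cmod (of_real (exp (c * u)) * (of_real (?f (exp u)) - ?E (exp u))))\<^sup>2"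
      unfolding mult.assoc e by (simp add: norm_mult power_mult_distrib mult.commute)
    then show "ennreal ((cmod (of_real (?f (exp u)) - ?E (exp u)))\<^sup>2 * exp u powr (2 * c - 1)) * ennreal (exp u) =
       ennreal ((cmod (of_real (log_profile c f u) - of_real (1 / (2 * pi)) * fourier G (- u)))\<^sup>2)"
      unfolding d by (subst ennreal_mult[symmetric]) auto
  qed
  also have "\<dots> \<le> ennreal (1 / (2 * pi)) * (\<integral>\<^sup>+t. ennreal ((cmod (mellin_real c f t - G t))\<^sup>2) \<partial>lborel)"
    using fourier_inversion_distance[OF h(1,2) _ G G2] fhat unfolding h(3) by simp
  finally show ?thesis .
qed

section \<open>Size and norm of the ridge factor\<close>

lemma abs_power2_powr: "t \<noteq> 0 \<Longrightarrow> (\<bar>t\<bar>\<^sup>2) powr a = \<bar>t\<bar> powr (2 * a)" for t a :: real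
  by (subst powr_numeral[symmetric], simp, simp only: powr_powr)

lemma integrable_bracket_powr:
  assumes "b > 1"
  shows "integrable lborel (\<lambda>t::real. (1 + t\<^sup>2) powr (- b / 2))"
proof -
  let ?p = "\<lambda>t::real. t powr (- b) * indicator {1..} t"
  have "((\<lambda>t. t powr (- b)) has_integral - (1 powr (- b + 1)) / (- b + 1)) {1..}"
    by (rule has_integral_powr_to_inf) (use assms in auto)
  then have "(\<integral>\<^sup>+t. ennreal (t powr (- b)) * indicator {1..} t \<partial>lborel) = ennreal (- (1 powr (- b + 1)) / (- b + 1))"
    by (rule nn_integral_has_integral_lebesgue'[rotated]) auto
  moreover have "(\<integral>\<^sup>+t. ennreal (?p t) \<partial>lborel) = (\<integral>\<^sup>+t. ennreal (t powr (- b)) * indicator {1..} t \<partial>lborel)"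
    by (intro nn_integral_cong) (auto simp: indicator_def)
  ultimately have p: "integrable lborel ?p"
    by (intro integrableI_bounded) auto
  have q: "integrable lborel (\<lambda>t. ?p (- t))"
    using lborel_integrable_real_affine[OF p, of "-1" 0] by simp
  have i: "integrable lborel (indicator {-1..1} :: real \<Rightarrow> real)"
    by (rule integrable_real_indicator) (use emeasure_bounded_finite[of "{-1..1::real}"] in simp_all)
  \<comment> \<open>Dominated by \<open>1\<close> near the origin and by \<open>\<bar>t\<bar> powr (- b)\<close> on the two tails.\<close>
  show ?thesis
  proof (rule Bochner_Integration.integrable_bound)
    show "integrable lborel (\<lambda>t. indicator {-1..1} t + ?p t + ?p (- t))"
      by (intro Bochner_Integration.integrable_add i p q)
    show "AE t in lborel. norm ((1 + t\<^sup>2) powr (- b / 2)) \<le> norm (indicator {-1..1} t + ?p t + ?p (- t))"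
    proof (rule AE_I2)
      fix t :: real
      have "(1 + t\<^sup>2) powr (- b / 2) \<le> indicator {-1..1} t + ?p t + ?p (- t)"
      proof (cases "\<bar>t\<bar> \<le> 1")
        case True
        have "(1 + t\<^sup>2) powr (- b / 2) \<le> 1 powr (- b / 2)"
          by (rule powr_mono2') (use assms in auto)
        moreover have "0 \<le> ?p t" "0 \<le> ?p (- t)" by (auto simp: indicator_def)
        moreover have "indicator {-1..1} t = (1::real)" using True by (auto simp: indicator_def)
        ultimately show ?thesis unfolding powr_one_eq_one by linarith
      next
        case False
        have "(1 + t\<^sup>2) powr (- b / 2) \<le> (\<bar>t\<bar>\<^sup>2) powr (- b / 2)"
          by (rule powr_mono2') (use assms False in auto)
        also have "\<dots> = \<bar>t\<bar> powr (- b)"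
          using False by (subst abs_power2_powr) auto
        also have "\<dots> \<le> indicator {-1..1} t + ?p t + ?p (- t)"
          using False by (auto simp: indicator_def abs_if)
        finally show ?thesis .
      qed
      then show "norm ((1 + t\<^sup>2) powr (- b / 2)) \<le> norm (indicator {-1..1} t + ?p t + ?p (- t))"
        by simp
    qed
  qed measurable
qed

lemma cmod_ridge:
  assumes "pos_density g"
  shows "cmod (ridge c g r k t) =
    cmod (mellin_real c g t) * cmod (mellin_real c g t) powr r / max (cmod (mellin_real c g t)) (1 / k) powr (r + 2)"
  by (simp add: ridge_def mellin_uminus[OF assms] norm_mult norm_divide)

text \<open>
  Write \<open>m\<close> for the modulus of the Mellin transform of \<open>g\<close> and \<open>q = max m (1 / k)\<close>, so that the ridge factor has modulus
\<open>m powr (r + 1) / q powr (r + 2)\<close>. The two bounds use \<open>m \<le> q\<close> in the numerator and \<open>1 / k \<le> q\<close> in the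
denominator.
\<close>

lemma cmod_ridge_le:
  assumes g: "pos_density g" and k: "k > 0" and r: "r > 0"
  shows "cmod (ridge c g r k t) \<le> k"
    and "cmod (ridge c g r k t) \<le> k powr (r + 2) * cmod (mellin_real c g t) powr (r + 1)"
proof -
  define m where "m = cmod (mellin_real c g t)"
  define q where "q = max m (1 / k)"
  have m: "m \<ge> 0" and q: "q > 0" "m \<le> q" "1 / k \<le> q" using k by (auto simp: m_def q_def less_max_iff_disj)
  have m1: "m * m powr r = m powr (r + 1)"
    using m by (cases "m = 0") (simp_all add: powr_add)
  have eq: "cmod (ridge c g r k t) = m powr (r + 1) / q powr (r + 2)"
    unfolding cmod_ridge[OF g] m_def[symmetric] q_def[symmetric] m1 ..
  have "m powr (r + 1) / q powr (r + 2) \<le> q powr (r + 1) / q powr (r + 2)"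
    using m q r by (intro divide_right_mono powr_mono2) auto
  also have "\<dots> = 1 / q"
    using q by (simp add: powr_diff[symmetric] powr_minus_divide)
  also have "\<dots> \<le> k"
    using q k by (simp add: field_simps)
  finally show "cmod (ridge c g r k t) \<le> k" unfolding eq .
  have "(1 / k) powr (r + 2) \<le> q powr (r + 2)"
    using k q r by (intro powr_mono2) auto
  then have "m powr (r + 1) / q powr (r + 2) \<le> m powr (r + 1) / (1 / k) powr (r + 2)"
    using k q by (intro divide_left_mono) auto
  also have "\<dots> = k powr (r + 2) * m powr (r + 1)"
    using k by (simp add: powr_divide)
  finally show "cmod (ridge c g r k t) \<le> k powr (r + 2) * cmod (mellin_real c g t) powr (r + 1)"
    unfolding eq m_def[symmetric] .
qed

text \<open>
  Since \<open>g\<close> is real, its Mellin transform at \<open>- t\<close> is the conjugate of the one at \<open>t\<close>. The product with the ridge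
factor is therefore the real number \<open>(m / max m (1 / k)) powr (r + 2)\<close>, which lies between \<open>0\<close> and \<open>1\<close>.
\<close>

lemma cmod_one_minus_ridge:
  assumes g: "pos_density g" and k: "k > 0" and r: "r > 0" and pos: "mellin_real c g t \<noteq> 0"
  shows "cmod (1 - mellin_real c g t * ridge c g r k t) \<le> 1"
    and "1 / k \<le> cmod (mellin_real c g t) \<Longrightarrow> mellin_real c g t * ridge c g r k t = 1"
proof -
  define m where "m = cmod (mellin_real c g t)"
  define q where "q = max m (1 / k)"
  have m: "m > 0" and q: "q > 0" "m \<le> q" using k pos by (auto simp: m_def q_def less_max_iff_disj)
  have "mellin_real c g t * ridge c g r k t =
      (mellin_real c g t * cnj (mellin_real c g t)) * of_real (m powr r) / of_real (q powr (r + 2))"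
    unfolding ridge_def m_def[symmetric] q_def[symmetric] mellin_uminus[OF g] by simp
  also have "\<dots> = of_real (m\<^sup>2 * m powr r / q powr (r + 2))"
    unfolding complex_norm_square[symmetric] m_def[symmetric] by simp
  also have "m\<^sup>2 * m powr r = m powr (r + 2)"
    using m by (simp add: powr_add)
  finally have eq: "mellin_real c g t * ridge c g r k t = of_real (m powr (r + 2) / q powr (r + 2))" .
  have "m powr (r + 2) \<le> q powr (r + 2)"
    using m q r by (intro powr_mono2) auto
  then have "0 \<le> m powr (r + 2) / q powr (r + 2)" "m powr (r + 2) / q powr (r + 2) \<le> 1"
    using q by auto
  then have "\<bar>1 - m powr (r + 2) / q powr (r + 2)\<bar> \<le> 1" by linarith
  then show "cmod (1 - mellin_real c g t * ridge c g r k t) \<le> 1"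
    unfolding eq by (metis norm_of_real of_real_1 of_real_diff)
  show "mellin_real c g t * ridge c g r k t = 1" if "1 / k \<le> cmod (mellin_real c g t)"
  proof -
    have "q = m" using that by (simp add: q_def m_def)
    then show ?thesis unfolding eq using m by simp
  qed
qed

lemma borel_measurable_ridge:
  assumes g: "pos_density g"
  shows "ridge c g r k \<in> borel_measurable borel"
proof -
  note [measurable] = borel_measurable_mellin[OF g]
  have "(\<lambda>t. mellin_real c g (- t)) \<in> borel_measurable borel"
    unfolding mellin_uminus[OF g] by measurable
  note [measurable] = this
  show ?thesis unfolding ridge_def[abs_def] by measurable
qed

lemma ridge_decay:
  assumes g: "pos_density g" and k: "k > 0" and r: "r > 0"
    and upper: "cmod (mellin_real c g t) \<le> C * (1 + t\<^sup>2) powr (- \<gamma> / 2)" and C: "C > 0"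
  shows "cmod (ridge c g r k t) \<le> k powr (r + 2) * C powr (r + 1) * (1 + t\<^sup>2) powr (- (\<gamma> * (r + 1)) / 2)"
proof -
  have "cmod (mellin_real c g t) powr (r + 1) \<le> (C * (1 + t\<^sup>2) powr (- \<gamma> / 2)) powr (r + 1)"
    using upper r by (intro powr_mono2) auto
  also have "\<dots> = C powr (r + 1) * (1 + t\<^sup>2) powr (- (\<gamma> * (r + 1)) / 2)"
    using C by (simp add: powr_mult powr_powr mult.commute)
  finally have "k powr (r + 2) * cmod (mellin_real c g t) powr (r + 1) \<le>
      k powr (r + 2) * (C powr (r + 1) * (1 + t\<^sup>2) powr (- (\<gamma> * (r + 1)) / 2))"
    by (rule mult_left_mono) simp
  then show ?thesis
    using cmod_ridge_le(2)[OF g k r, of c t] by (simp add: mult.assoc)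
qed

lemma integrable_ridge:
  assumes g: "pos_density g" and k: "k > 0" and r: "r > 0"
    and upper: "\<And>t. cmod (mellin_real c g t) \<le> C * (1 + t\<^sup>2) powr (- \<gamma> / 2)" and C: "C > 0"
    and exponent: "\<gamma> * (r + 1) > 1"
  shows "integrable lborel (ridge c g r k)"
proof (rule Bochner_Integration.integrable_bound)
  note [measurable] = borel_measurable_ridge[OF g]
  show "integrable lborel (\<lambda>t. k powr (r + 2) * C powr (r + 1) * (1 + t\<^sup>2) powr (- (\<gamma> * (r + 1)) / 2))"
    by (rule integrable_mult_right) (rule integrable_bracket_powr[OF exponent])
  show "ridge c g r k \<in> borel_measurable lborel" by measurable
  show "AE t in lborel. norm (ridge c g r k t) \<le>
      norm (k powr (r + 2) * C powr (r + 1) * (1 + t\<^sup>2) powr (- (\<gamma> * (r + 1)) / 2))"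
    using ridge_decay[OF g k r upper C] by (auto intro!: AE_I2 order_trans[OF _ abs_ge_self])
qed

text \<open>
  On the scale \<open>T = k powr (1 / \<gamma>)\<close> the two bounds on the ridge factor combine to a multiple of
\<open>k\<^sup>2 / (1 + (t / T)\<^sup>2)\<close>, whose integral is \<open>k\<^sup>2 * T\<close> up to a constant.
\<close>

lemma ridge_energy_le:
  assumes g: "pos_density g" and k: "k > 0" and r: "r > 0" and \<gamma>: "\<gamma> > 0"
    and upper: "\<And>t. cmod (mellin_real c g t) \<le> C * (1 + t\<^sup>2) powr (- \<gamma> / 2)" and C: "C > 0"
    and exponent: "\<gamma> * (r + 1) > 1"
  shows "(\<integral>\<^sup>+t. ennreal ((cmod (ridge c g r k t))\<^sup>2) \<partial>lborel) \<le>
    ennreal (2 * (1 + (C powr (r + 1))\<^sup>2) * (\<integral>z. (1 + z\<^sup>2) powr (- 2 / 2) \<partial>(lborel :: real measure)) * k powr (2 + 1 / \<gamma>))"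
proof -
  define T where "T = k powr (1 / \<gamma>)"
  define A where "A = C powr (r + 1)"
  let ?J = "\<integral>z. (1 + z\<^sup>2) powr (- 2 / 2) \<partial>(lborel :: real measure)"
  have T: "T > 0" and A: "A \<ge> 0" using k by (auto simp: T_def A_def)
  have J: "integrable lborel (\<lambda>z::real. (1 + z\<^sup>2) powr (- 2 / 2))"
    by (rule integrable_bracket_powr) simp
  have bound: "(cmod (ridge c g r k t))\<^sup>2 \<le> 2 * (1 + A\<^sup>2) * k\<^sup>2 * (1 + (t / T)\<^sup>2) powr (- 2 / 2)" for t
  proof -
    have pos: "1 + (t / T)\<^sup>2 > 0" by (rule add_pos_nonneg) auto
    have "(cmod (ridge c g r k t))\<^sup>2 * (1 + (t / T)\<^sup>2) \<le> 2 * (1 + A\<^sup>2) * k\<^sup>2"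
    proof (cases "\<bar>t\<bar> \<le> T")
      case True
      have "(cmod (ridge c g r k t))\<^sup>2 \<le> k\<^sup>2"
        by (rule power_mono[OF cmod_ridge_le(1)[OF g k r]]) simp
      moreover have "(t / T)\<^sup>2 \<le> 1"
        using True T by (simp add: power_divide abs_le_square_iff[symmetric])
      ultimately have "(cmod (ridge c g r k t))\<^sup>2 * (1 + (t / T)\<^sup>2) \<le> k\<^sup>2 * 2"
        by (intro mult_mono) auto
      also have "\<dots> \<le> 2 * (1 + A\<^sup>2) * k\<^sup>2" by (simp add: algebra_simps)
      finally show ?thesis .
    next
      case False
      define z where "z = \<bar>t\<bar> / T"
      have z: "z > 1" using False T by (simp add: z_def)
      have tz: "\<bar>t\<bar> = T * z" using T by (simp add: z_def)
      have "(1 + t\<^sup>2) powr (- (\<gamma> * (r + 1)) / 2) \<le> (\<bar>t\<bar>\<^sup>2) powr (- (\<gamma> * (r + 1)) / 2)"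
        by (rule powr_mono2') (use exponent False T in auto)
      also have "\<dots> = \<bar>t\<bar> powr (- (\<gamma> * (r + 1)))"
        using False T by (subst abs_power2_powr) auto
      also have "\<dots> = T powr (- (\<gamma> * (r + 1))) * z powr (- (\<gamma> * (r + 1)))"
        unfolding tz using T z by (simp add: powr_mult)
      also have "T powr (- (\<gamma> * (r + 1))) = k powr (- (r + 1))"
      proof -
        have "1 / \<gamma> * - (\<gamma> * (r + 1)) = - (r + 1)" using \<gamma> by (simp add: field_simps)
        then show ?thesis unfolding T_def powr_powr by simp
      qed
      also have "z powr (- (\<gamma> * (r + 1))) \<le> z powr (- 1)"
        using z exponent by (intro powr_mono) auto
      finally have tail: "(1 + t\<^sup>2) powr (- (\<gamma> * (r + 1)) / 2) \<le> k powr (- (r + 1)) * z powr (- 1)"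
        by (simp add: mult_left_mono)
      have "cmod (ridge c g r k t) \<le> k powr (r + 2) * A * (k powr (- (r + 1)) * z powr (- 1))"
        unfolding A_def by (rule order_trans[OF ridge_decay[OF g k r upper C]]) (intro mult_left_mono tail, simp)
      also have "\<dots> = (k powr (r + 2) * k powr (- (r + 1))) * A * z powr (- 1)"
        by simp
      also have "\<dots> = k * A / z"
        using k z by (simp add: powr_minus_divide flip: powr_add)
      finally have "(cmod (ridge c g r k t))\<^sup>2 \<le> (k * A / z)\<^sup>2"
        by (rule power_mono) simp
      moreover have "1 + (t / T)\<^sup>2 \<le> 2 * z\<^sup>2"
      proof -
        have "(t / T)\<^sup>2 = z\<^sup>2" by (simp add: z_def power_divide)
        moreover have "1 \<le> z\<^sup>2" using z by (intro one_le_power) simp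
        ultimately show ?thesis by linarith
      qed
      ultimately have "(cmod (ridge c g r k t))\<^sup>2 * (1 + (t / T)\<^sup>2) \<le> (k * A / z)\<^sup>2 * (2 * z\<^sup>2)"
        by (intro mult_mono) auto
      also have "\<dots> = 2 * A\<^sup>2 * k\<^sup>2"
        using z by (simp add: power_mult_distrib power_divide)
      also have "\<dots> \<le> 2 * (1 + A\<^sup>2) * k\<^sup>2" by (simp add: algebra_simps)
      finally show ?thesis .
    qed
    then show ?thesis
      using pos by (simp add: powr_minus_divide pos_le_divide_eq)
  qed
  have "(\<integral>\<^sup>+t. ennreal ((cmod (ridge c g r k t))\<^sup>2) \<partial>lborel) \<le>
      (\<integral>\<^sup>+t. ennreal (2 * (1 + A\<^sup>2) * k\<^sup>2) * ennreal ((1 + (t / T)\<^sup>2) powr (- 2 / 2)) \<partial>lborel)"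
    by (intro nn_integral_mono) (use bound in \<open>simp add: ennreal_leI flip: ennreal_mult\<close>)
  also have "\<dots> = ennreal (2 * (1 + A\<^sup>2) * k\<^sup>2) * (\<integral>\<^sup>+t. ennreal ((1 + (t / T)\<^sup>2) powr (- 2 / 2)) \<partial>lborel)"
    by (rule nn_integral_cmult) measurable
  also have "(\<integral>\<^sup>+t. ennreal ((1 + (t / T)\<^sup>2) powr (- 2 / 2)) \<partial>lborel) = ennreal T * (\<integral>\<^sup>+z. ennreal ((1 + z\<^sup>2) powr (- 2 / 2)) \<partial>lborel)"
    using T by (subst nn_integral_real_affine[where c=T and t=0]) auto
  also have "(\<integral>\<^sup>+z. ennreal ((1 + z\<^sup>2) powr (- 2 / 2)) \<partial>lborel) = ennreal ?J"
    by (rule nn_integral_eq_integral[OF J]) simp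
  also have "ennreal (2 * (1 + A\<^sup>2) * k\<^sup>2) * (ennreal T * ennreal ?J) = ennreal (2 * (1 + A\<^sup>2) * k\<^sup>2 * (T * ?J))"
    using T by (simp add: ennreal_mult integral_nonneg_AE)
  also have "2 * (1 + A\<^sup>2) * k\<^sup>2 * (T * ?J) = 2 * (1 + A\<^sup>2) * ?J * k powr (2 + 1 / \<gamma>)"
    unfolding T_def using k by (simp add: powr_add)
  finally show ?thesis unfolding A_def .
qed

section \<open>Bias, variance and the rate\<close>

lemma mellin_energy_finite:
  assumes "s > 0" and f: "f \<in> mellin_sobolev_class c s L"
  shows "(\<integral>\<^sup>+t. ennreal ((cmod (mellin_real c f t))\<^sup>2) \<partial>lborel) < \<infinity>"
proof -
  have "(\<integral>\<^sup>+t. ennreal ((cmod (mellin_real c f t))\<^sup>2) \<partial>lborel) \<le> mellin_sobolev_sq s c f"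
    unfolding mellin_sobolev_sq_def
  proof (intro nn_integral_mono ennreal_leI)
    fix t :: real
    have "1 \<le> (1 + t\<^sup>2) powr s" using assms(1) by (intro ge_one_powr_ge_zero) auto
    then show "(cmod (mellin_real c f t))\<^sup>2 \<le> (1 + t\<^sup>2) powr s * (cmod (mellin_real c f t))\<^sup>2"
      using mult_right_mono[of 1 "(1 + t\<^sup>2) powr s" "(cmod (mellin_real c f t))\<^sup>2"] by simp
  qed
  also have "\<dots> \<le> ennreal L" using f by (simp add: mellin_sobolev_class_def)
  also have "\<dots> < \<infinity>" by simp
  finally show ?thesis .
qed

text \<open>
  All observations are positive almost surely, which is where the empirical transform is an average of
characters and the inversion inequality applies. Tonelli's theorem then moves the expectation inside the
integral over \<open>t\<close>.
\<close>

lemma ridge_risk_le_bias_variance: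
  assumes "s > 0" and f: "f \<in> mellin_sobolev_class c s L" and L: "L > 0"
    and g: "pos_density g" and mg: "pos_moment g (2 * (c - 1)) < \<infinity>"
    and k: "k > 0" and r: "r > 0" and n: "n \<ge> 1"
    and R: "integrable lborel (ridge c g r k)"
  shows "ridge_risk c g r k n f \<le> ennreal (1 / (2 * pi)) *
    ((\<integral>\<^sup>+t. ennreal ((cmod (mellin_real c f t))\<^sup>2 * (cmod (1 - mellin_real c g t * ridge c g r k t))\<^sup>2) \<partial>lborel) +
     ennreal (L * enn2real (pos_moment g (2 * (c - 1))) / real n) * (\<integral>\<^sup>+t. ennreal ((cmod (ridge c g r k t))\<^sup>2) \<partial>lborel))"
proof -
  have fd: "pos_density f" and fL: "pos_moment f (2 * (c - 1)) \<le> ennreal L"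
    using f by (auto simp: mellin_sobolev_class_def)
  have mf: "pos_moment f (2 * (c - 1)) < \<infinity>"
    using le_less_trans[OF fL ennreal_less_top] by simp
  note [measurable] = borel_measurable_mellin[OF fd] borel_measurable_mellin[OF g] borel_measurable_ridge[OF g]
  let ?M = "pos_law (mult_conv f g)" and ?R = "ridge c g r k" and ?N = "sample_law n f g"
  let ?S = "enn2real (pos_moment f (2 * (c - 1))) * enn2real (pos_moment g (2 * (c - 1)))"
  note Y = product_law_moments[OF fd g mf mg]
  interpret M: prob_space ?M by (rule Y(1))
  interpret N: prob_space ?N unfolding sample_law_def by (rule prob_space_PiM) (rule Y(1))
  interpret NL: pair_sigma_finite ?N lborel ..
  define \<mu> where "\<mu> = (\<lambda>Y t. (\<Sum>j = 1..n. mellin_char c t (Y j)) / of_nat n)"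
  have \<mu>_measurable: "(\<lambda>p. \<mu> (fst p) (snd p)) \<in> borel_measurable (?N \<Otimes>\<^sub>M lborel)"
  proof -
    have [measurable]: "(\<lambda>p. fst p j) \<in> borel_measurable (?N \<Otimes>\<^sub>M lborel)" if "j \<in> {1..n}" for j
    proof -
      have "(\<lambda>Y. Y j) \<in> borel_measurable ?N"
        unfolding sample_law_def using measurable_component_singleton[OF that, of "\<lambda>_. ?M"]
        by (simp add: measurable_cong_sets[OF refl sets_pos_law])
      then show ?thesis by (rule measurable_compose[OF measurable_fst])
    qed
    show ?thesis
      unfolding \<mu>_def by measurable
  qed
  have emp: "empirical_mellin c n Y t = \<mu> Y t" if "\<And>j. j \<in> {1..n} \<Longrightarrow> 0 < Y j" for Y t
    unfolding empirical_mellin_def \<mu>_def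
    by (intro arg_cong2[where f="(/)"] sum.cong refl) (use that in \<open>auto simp: complex_powr_eq_mellin_char\<close>)
  have loss: "weighted_norm_sq c (\<lambda>x. of_real (f x) - ridge_estimator c g r k n Y x) \<le>
      ennreal (1 / (2 * pi)) * (\<integral>\<^sup>+t. ennreal ((cmod (mellin_real c f t - \<mu> Y t * ?R t))\<^sup>2) \<partial>lborel)"
    if pos: "\<And>j. j \<in> {1..n} \<Longrightarrow> 0 < Y j" for Y
  proof -
    define B where "B = (\<Sum>j = 1..n. Y j powr (c - 1)) / real n"
    have [measurable]: "\<mu> Y \<in> borel_measurable borel"
      unfolding \<mu>_def by measurable
    have B: "cmod (\<mu> Y t) \<le> B" for t
      unfolding \<mu>_def B_def norm_divide norm_of_nat
      by (intro divide_right_mono order_trans[OF norm_sum]) (auto simp: cmod_mellin_char)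
    then have B0: "B \<ge> 0" using norm_ge_zero order_trans by blast
    have "integrable lborel (\<lambda>t. ?R t * \<mu> Y t)"
      by (rule integrable_mult_bounded[OF R _ B]) measurable
    then have G: "integrable lborel (\<lambda>t. \<mu> Y t * ?R t)"
      by (simp only: mult.commute)
    have G2: "integrable lborel (\<lambda>t. (cmod (\<mu> Y t * ?R t))\<^sup>2)"
    proof (rule Bochner_Integration.integrable_bound)
      show "integrable lborel (\<lambda>t. (B * k) * cmod (\<mu> Y t * ?R t))"
        by (intro integrable_mult_right integrable_norm G)
      show "AE t in lborel. norm ((cmod (\<mu> Y t * ?R t))\<^sup>2) \<le> norm ((B * k) * cmod (\<mu> Y t * ?R t))"
      proof (rule AE_I2)
        fix t
        have "cmod (\<mu> Y t * ?R t) \<le> B * k"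
          unfolding norm_mult using B0 k by (intro mult_mono cmod_ridge_le(1)[OF g k r] B) auto
        then have "(cmod (\<mu> Y t * ?R t))\<^sup>2 \<le> (B * k) * cmod (\<mu> Y t * ?R t)"
          unfolding power2_eq_square by (rule mult_right_mono) simp
        also have "\<dots> \<le> norm ((B * k) * cmod (\<mu> Y t * ?R t))" by simp
        finally show "norm ((cmod (\<mu> Y t * ?R t))\<^sup>2) \<le> norm ((B * k) * cmod (\<mu> Y t * ?R t))" by simp
      qed
    qed measurable
    have emp': "empirical_mellin c n Y t = \<mu> Y t" for t
      by (rule emp) (rule pos)
    have "ridge_estimator c g r k n Y x = 1 / of_real (2 * pi) *
        (LINT t|lborel. of_real x powr Complex (- c) (- t) * (\<mu> Y t * ?R t))" for x
      unfolding ridge_estimator_def emp' by (simp only: mult.assoc)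
    then show ?thesis
      using mellin_inversion_distance[OF fd mf mellin_energy_finite[OF assms(1) f] G G2]
      by simp
  qed
  have positive: "AE Y in ?N. \<forall>j\<in>{1..n}. 0 < Y j"
    unfolding sample_law_def
    by (intro AE_finite_allI finite_atLeastAtMost AE_PiM_component Y(1) Y(2)) auto
  have "ridge_risk c g r k n f \<le>
      (\<integral>\<^sup>+Y. ennreal (1 / (2 * pi)) * (\<integral>\<^sup>+t. ennreal ((cmod (mellin_real c f t - \<mu> Y t * ?R t))\<^sup>2) \<partial>lborel) \<partial>?N)"
    unfolding ridge_risk_def by (rule nn_integral_mono_AE) (use positive in \<open>eventually_elim, auto intro!: loss\<close>)
  also have "\<dots> = ennreal (1 / (2 * pi)) *
      (\<integral>\<^sup>+Y. (\<integral>\<^sup>+t. ennreal ((cmod (mellin_real c f t - \<mu> Y t * ?R t))\<^sup>2) \<partial>lborel) \<partial>?N)"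
  proof (rule nn_integral_cmult)
    show "(\<lambda>Y. \<integral>\<^sup>+t. ennreal ((cmod (mellin_real c f t - \<mu> Y t * ?R t))\<^sup>2) \<partial>lborel) \<in> borel_measurable ?N"
      using \<mu>_measurable by measurable
  qed
  also have "(\<integral>\<^sup>+Y. (\<integral>\<^sup>+t. ennreal ((cmod (mellin_real c f t - \<mu> Y t * ?R t))\<^sup>2) \<partial>lborel) \<partial>?N) =
      (\<integral>\<^sup>+t. (\<integral>\<^sup>+Y. ennreal ((cmod (mellin_real c f t - \<mu> Y t * ?R t))\<^sup>2) \<partial>?N) \<partial>lborel)"
    by (rule NL.Fubini'[symmetric]) (use \<mu>_measurable in measurable)
  also have "\<dots> \<le> (\<integral>\<^sup>+t. ennreal ((cmod (mellin_real c f t - mellin_real c f t * mellin_real c g t * ?R t))\<^sup>2 +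
      (cmod (?R t))\<^sup>2 * ?S / real n) \<partial>lborel)"
  proof (rule nn_integral_mono)
    fix t :: real
    show "(\<integral>\<^sup>+Y. ennreal ((cmod (mellin_real c f t - \<mu> Y t * ?R t))\<^sup>2) \<partial>?N) \<le>
      ennreal ((cmod (mellin_real c f t - mellin_real c f t * mellin_real c g t * ?R t))\<^sup>2 + (cmod (?R t))\<^sup>2 * ?S / real n)"
      using M.sample_mean_risk[OF Y(3)[of t] Y(4)[of t] n, where a="mellin_real c f t" and b="?R t"]
      unfolding \<mu>_def sample_law_def Y(5) Y(6) .
  qed
  also have "\<dots> \<le> (\<integral>\<^sup>+t. ennreal ((cmod (mellin_real c f t))\<^sup>2 * (cmod (1 - mellin_real c g t * ?R t))\<^sup>2) +
      ennreal (L * enn2real (pos_moment g (2 * (c - 1))) / real n) * ennreal ((cmod (?R t))\<^sup>2) \<partial>lborel)"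
  proof (rule nn_integral_mono)
    fix t :: real
    have "enn2real (pos_moment f (2 * (c - 1))) \<le> L"
      using fL L by (intro enn2real_leI) auto
    then have "(cmod (?R t))\<^sup>2 * ?S / real n \<le> L * enn2real (pos_moment g (2 * (c - 1))) / real n * (cmod (?R t))\<^sup>2"
      by (simp add: mult.commute mult_left_mono divide_right_mono mult_right_mono)
    moreover have "mellin_real c f t - mellin_real c f t * mellin_real c g t * ?R t =
        mellin_real c f t * (1 - mellin_real c g t * ?R t)"
      by (simp add: algebra_simps)
    ultimately show "ennreal ((cmod (mellin_real c f t - mellin_real c f t * mellin_real c g t * ?R t))\<^sup>2 + (cmod (?R t))\<^sup>2 * ?S / real n)
      \<le> ennreal ((cmod (mellin_real c f t))\<^sup>2 * (cmod (1 - mellin_real c g t * ?R t))\<^sup>2) +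
      ennreal (L * enn2real (pos_moment g (2 * (c - 1))) / real n) * ennreal ((cmod (?R t))\<^sup>2)"
      using L by (simp only: norm_mult power_mult_distrib)
        (simp add: ennreal_leI flip: ennreal_mult ennreal_plus)
  qed
  also have "\<dots> = (\<integral>\<^sup>+t. ennreal ((cmod (mellin_real c f t))\<^sup>2 * (cmod (1 - mellin_real c g t * ?R t))\<^sup>2) \<partial>lborel) +
      ennreal (L * enn2real (pos_moment g (2 * (c - 1))) / real n) * (\<integral>\<^sup>+t. ennreal ((cmod (?R t))\<^sup>2) \<partial>lborel)"
    by (subst nn_integral_add, measurable, subst nn_integral_cmult, measurable)
  finally show ?thesis by (simp add: mult_left_mono)
qed

text \<open>
  Where the Mellin transform of \<open>g\<close> is below \<open>1 / k\<close> in modulus, its lower bound gives \<open>a * k \<le> (1 + t\<^sup>2) powr (\<gamma> / 2)\<close>; raised to the power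
\<open>2 * s / \<gamma>\<close>, this trades the Sobolev weight for a power of \<open>k\<close>. Elsewhere the bias vanishes.
\<close>

lemma ridge_bias_le:
  assumes s: "s > 0" and f: "f \<in> mellin_sobolev_class c s L"
    and g: "pos_density g" and k: "k > 0" and r: "r > 0" and \<gamma>: "\<gamma> > 0" and a: "a > 0"
    and lower: "\<And>t. a * (1 + t\<^sup>2) powr (- \<gamma> / 2) \<le> cmod (mellin_real c g t)"
  shows "(\<integral>\<^sup>+t. ennreal ((cmod (mellin_real c f t))\<^sup>2 * (cmod (1 - mellin_real c g t * ridge c g r k t))\<^sup>2) \<partial>lborel)
    \<le> ennreal ((a * k) powr (- (2 * s / \<gamma>)) * L)"
proof -
  have fd: "pos_density f" and fL: "mellin_sobolev_sq s c f \<le> ennreal L"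
    using f by (auto simp: mellin_sobolev_class_def)
  note [measurable] = borel_measurable_mellin[OF fd]
  let ?q = "(a * k) powr (- (2 * s / \<gamma>))"
  have "(\<integral>\<^sup>+t. ennreal ((cmod (mellin_real c f t))\<^sup>2 * (cmod (1 - mellin_real c g t * ridge c g r k t))\<^sup>2) \<partial>lborel)
    \<le> (\<integral>\<^sup>+t. ennreal ?q * ennreal ((1 + t\<^sup>2) powr s * (cmod (mellin_real c f t))\<^sup>2) \<partial>lborel)"
  proof (rule nn_integral_mono)
    fix t :: real
    let ?m = "cmod (mellin_real c g t)"
    have pos: "1 + t\<^sup>2 > 0" by (rule add_pos_nonneg) auto
    have "0 < a * (1 + t\<^sup>2) powr (- \<gamma> / 2)" using a pos by simp
    then have nz: "mellin_real c g t \<noteq> 0" using lower[of t] by auto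
    have "(cmod (1 - mellin_real c g t * ridge c g r k t))\<^sup>2 \<le> ?q * (1 + t\<^sup>2) powr s"
    proof (cases "1 / k \<le> ?m")
      case True
      then show ?thesis using cmod_one_minus_ridge(2)[OF g k r nz] by simp
    next
      case False
      then have "a * (1 + t\<^sup>2) powr (- \<gamma> / 2) < 1 / k" using lower[of t] by linarith
      then have "a * k \<le> (1 + t\<^sup>2) powr (\<gamma> / 2)"
        using k pos by (simp add: powr_minus_divide field_simps)
      then have "(a * k) powr (2 * s / \<gamma>) \<le> ((1 + t\<^sup>2) powr (\<gamma> / 2)) powr (2 * s / \<gamma>)"
        using a k s \<gamma> by (intro powr_mono2) auto
      also have "\<dots> = (1 + t\<^sup>2) powr s"
        using \<gamma> by (simp add: powr_powr)
      finally have "1 \<le> ?q * (1 + t\<^sup>2) powr s"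
        using a k by (simp add: powr_minus_divide field_simps)
      moreover have "(cmod (1 - mellin_real c g t * ridge c g r k t))\<^sup>2 \<le> 1"
        using cmod_one_minus_ridge(1)[OF g k r nz] by (simp add: power_le_one)
      ultimately show ?thesis by linarith
    qed
    then have "(cmod (mellin_real c f t))\<^sup>2 * (cmod (1 - mellin_real c g t * ridge c g r k t))\<^sup>2 \<le>
        (cmod (mellin_real c f t))\<^sup>2 * (?q * (1 + t\<^sup>2) powr s)"
      by (rule mult_left_mono) simp
    then show "ennreal ((cmod (mellin_real c f t))\<^sup>2 * (cmod (1 - mellin_real c g t * ridge c g r k t))\<^sup>2) \<le>
      ennreal ?q * ennreal ((1 + t\<^sup>2) powr s * (cmod (mellin_real c f t))\<^sup>2)"
      by (simp add: ennreal_leI mult_ac flip: ennreal_mult)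
  qed
  also have "\<dots> = ennreal ?q * mellin_sobolev_sq s c f"
    unfolding mellin_sobolev_sq_def by (rule nn_integral_cmult) measurable
  also have "\<dots> \<le> ennreal ?q * ennreal L"
    by (rule mult_left_mono[OF fL]) simp
  finally show ?thesis by (simp add: ennreal_mult')
qed

theorem theorem1:
  fixes c s L r \<gamma> c\<^sub>g C\<^sub>g :: real and g :: "real \<Rightarrow> real"
  assumes "s > 0" and "L > 0"
    and "pos_density g"
    and "pos_moment g (2 * (c - 1)) < \<infinity>"
    and "c\<^sub>g > 0" and "C\<^sub>g > 0" and "\<gamma> > 0"
    and "\<And>t. c\<^sub>g * (1 + t\<^sup>2) powr (- \<gamma> / 2) \<le> cmod (mellin_real c g t)"
    and "\<And>t. cmod (mellin_real c g t) \<le> C\<^sub>g * (1 + t\<^sup>2) powr (- \<gamma> / 2)"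
    and "r > max 0 (1 / \<gamma> - 1)"
  shows "\<exists>C::real. C > 0 \<and> (\<forall>n::nat. n \<ge> 1 \<longrightarrow>
    (SUP f \<in> mellin_sobolev_class c s L.
       ridge_risk c g r (real n powr (\<gamma> / (2 * s + 2 * \<gamma> + 1))) n f)
    \<le> ennreal (C * real n powr (- (2 * s) / (2 * s + 2 * \<gamma> + 1))))"
proof -
  define p where "p = 2 * s + 2 * \<gamma> + 1"
  define m where "m = enn2real (pos_moment g (2 * (c - 1)))"
  define K where "K = 2 * (1 + (C\<^sub>g powr (r + 1))\<^sup>2) * (\<integral>z. (1 + z\<^sup>2) powr (- 2 / 2) \<partial>(lborel :: real measure))"
  define C where "C = 1 / (2 * pi) * (c\<^sub>g powr (- (2 * s / \<gamma>)) * L + L * m * K)"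
  have p: "p > 0" using assms(1,7) by (simp add: p_def)
  have r: "r > 0" and r': "r > 1 / \<gamma> - 1" using assms(10) by auto
  have exponent: "\<gamma> * (r + 1) > 1"
    using r' assms(7) by (simp add: field_simps)
  have m: "m \<ge> 0" by (simp add: m_def)
  have K: "K \<ge> 0" unfolding K_def by (intro mult_nonneg_nonneg integral_nonneg_AE) auto
  have "C > 0"
    unfolding C_def using assms(2,5) m K by (intro mult_pos_pos add_pos_nonneg) auto
  moreover have "ridge_risk c g r (real n powr (\<gamma> / p)) n f \<le> ennreal (C * real n powr (- (2 * s) / p))"
    if n: "n \<ge> 1" and f: "f \<in> mellin_sobolev_class c s L" for n f
  proof -
    define k where "k = real n powr (\<gamma> / p)"
    define \<rho> where "\<rho> = real n powr (- (2 * s) / p)"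
    have k: "k > 0" using n by (simp add: k_def)
    \<comment> \<open>The value of \<open>k\<close> balances the two rates.\<close>
    have bias_rate: "(c\<^sub>g * k) powr (- (2 * s / \<gamma>)) = c\<^sub>g powr (- (2 * s / \<gamma>)) * \<rho>"
      using assms(5,7) k by (simp add: powr_mult k_def \<rho>_def powr_powr)
    have variance_rate: "k powr (2 + 1 / \<gamma>) / real n = \<rho>"
    proof -
      have "k powr (2 + 1 / \<gamma>) / real n = real n powr (\<gamma> / p * (2 + 1 / \<gamma>) - 1)"
        using n by (simp add: k_def powr_powr powr_diff)
      also have "\<gamma> / p * (2 + 1 / \<gamma>) - 1 = - (2 * s) / p"
        using p assms(7) by (simp add: field_simps) (simp add: p_def algebra_simps)
      finally show ?thesis unfolding \<rho>_def .
    qed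
    have R: "integrable lborel (ridge c g r k)"
      by (rule integrable_ridge[OF assms(3) k r assms(9) assms(6) exponent])
    have "ridge_risk c g r k n f \<le> ennreal (1 / (2 * pi)) *
        (ennreal ((c\<^sub>g * k) powr (- (2 * s / \<gamma>)) * L) + ennreal (L * m / real n) * ennreal (K * k powr (2 + 1 / \<gamma>)))"
      unfolding m_def K_def
      by (rule order_trans[OF ridge_risk_le_bias_variance[OF assms(1) f assms(2-4) k r n R]])
         (intro mult_left_mono add_mono ridge_bias_le[OF assms(1) f assms(3) k r assms(7,5,8)]
            ridge_energy_le[OF assms(3) k r assms(7) assms(9) assms(6) exponent], simp_all)
    also have "\<dots> = ennreal (1 / (2 * pi) * ((c\<^sub>g * k) powr (- (2 * s / \<gamma>)) * L + L * m / real n * (K * k powr (2 + 1 / \<gamma>))))"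
      using assms(2) m K by (simp flip: ennreal_mult ennreal_plus)
    also have "L * m / real n * (K * k powr (2 + 1 / \<gamma>)) = L * m * K * (k powr (2 + 1 / \<gamma>) / real n)"
      by simp
    also have "1 / (2 * pi) * ((c\<^sub>g * k) powr (- (2 * s / \<gamma>)) * L + L * m * K * (k powr (2 + 1 / \<gamma>) / real n)) = C * \<rho>"
      unfolding bias_rate variance_rate C_def by (simp add: algebra_simps)
    finally show ?thesis unfolding k_def \<rho>_def .
  qed
  ultimately show ?thesis
    unfolding p_def[symmetric] by (intro exI[of _ C] conjI allI impI SUP_least) auto
qed

end
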